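(* (i) For $n\in\{4,5\}$, $E(\mathcal{P}_e(S_n))=E(\Delta_D(S_n))\subsetneq E(\Delta(S_n))$. (ii) For $n\geq 6$, $E(\mathcal{P}_e(S_n))\subsetneq E(\Delta_D(S_n))\subsetneq E(\Delta(S_n))$.
   Context: $S_n$ is the symmetric group; $E(\cdot)$ denotes edge set. The commuting graph $\Delta(G)$ has vertex set $G$ with distinct $x,y$ adjacent iff $xy=yx$. The enhanced power graph $\mathcal{P}_e(G)$ has vertex set $G$ with distinct $x,y$ adjacent iff $\langle x,y\rangle$ is cyclic. The deep commuting graph $\Delta_D(G)$ has vertex set $G$, distinct vertices adjacent iff their preimages commute in a Schur cover $\tilde G$ of $G$ (a central extension $\{e\}\to M(G)\to\tilde G\to G\to\{e\}$ with kernel contained in $Z(\tilde G)\cap[\tilde G,\tilde G]$, of maximal order; $M(G)$ the Schur multiplier). *)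

theory Defs
  imports "HOL-Algebra.Algebra"
begin

definition grp_center :: "('a, 'm) monoid_scheme \<Rightarrow> 'a set" where
  "grp_center H = {z \<in> carrier H. \<forall>x \<in> carrier H. z \<otimes>\<^bsub>H\<^esub> x = x \<otimes>\<^bsub>H\<^esub> z}"

definition stem_extension ::
  "('a, 'm) monoid_scheme \<Rightarrow> ('b, 'n) monoid_scheme \<Rightarrow> ('b \<Rightarrow> 'a) \<Rightarrow> bool" where
  "stem_extension G H \<pi> \<longleftrightarrow> group G \<and> group H \<and> \<pi> \<in> epi H G \<and>
     kernel H G \<pi> \<subseteq> grp_center H \<inter> derived H (carrier H)"

(* A Schur cover: a finite stem extension whose kernel has maximal order among all
   finite stem extensions of G (every finite group is isomorphic to one with carrier
   a set of naturals, so comparing with stem extensions on nat carriers suffices). *)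
definition schur_cover ::
  "('a, 'm) monoid_scheme \<Rightarrow> ('b, 'n) monoid_scheme \<Rightarrow> ('b \<Rightarrow> 'a) \<Rightarrow> bool" where
  "schur_cover G H \<pi> \<longleftrightarrow> stem_extension G H \<pi> \<and> finite (carrier H) \<and>
     (\<forall>(H' :: nat monoid) \<pi>'. stem_extension G H' \<pi>' \<and> finite (carrier H') \<longrightarrow>
        card (kernel H' G \<pi>') \<le> card (kernel H G \<pi>))"

definition commuting_edges :: "('a, 'm) monoid_scheme \<Rightarrow> 'a set set" where
  "commuting_edges G = {{x, y} | x y. x \<in> carrier G \<and> y \<in> carrier G \<and> x \<noteq> y \<and>
      x \<otimes>\<^bsub>G\<^esub> y = y \<otimes>\<^bsub>G\<^esub> x}"

definition enhanced_power_edges :: "('a, 'm) monoid_scheme \<Rightarrow> 'a set set" where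
  "enhanced_power_edges G = {{x, y} | x y. x \<in> carrier G \<and> y \<in> carrier G \<and> x \<noteq> y \<and>
      cyclic_group (subgroup_generated G {x, y})}"

(* Deep commuting graph w.r.t. the Schur cover (H, \<pi>): distinct x, y adjacent iff
   their preimages in H commute (independent of the choice of preimages since the
   kernel is central). *)
definition deep_commuting_edges ::
  "('a, 'm) monoid_scheme \<Rightarrow> ('b, 'n) monoid_scheme \<Rightarrow> ('b \<Rightarrow> 'a) \<Rightarrow> 'a set set" where
  "deep_commuting_edges G H \<pi> = {{x, y} | x y. x \<in> carrier G \<and> y \<in> carrier G \<and> x \<noteq> y \<and>
      (\<forall>x' \<in> carrier H. \<forall>y' \<in> carrier H. \<pi> x' = x \<and> \<pi> y' = y \<longrightarrow>
          x' \<otimes>\<^bsub>H\<^esub> y' = y' \<otimes>\<^bsub>H\<^esub> x')}"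

end

theory Submission
  imports Defs
begin

text \<open>
Everything rests on one property of a Schur cover H of the symmetric group of degree n, n at least 4:
lifts of two disjoint transpositions do not commute. The Clifford algebra provides a stem extension
with kernel of order 2, generated by lifts of the transpositions (a b) to the operators
(e_a - e_b) / sqrt 2, so the kernel of H is not trivial. If lifts of disjoint transpositions commuted
in H, then the conjugacy class of a lift t of (1 2) would map bijectively to the transpositions, and
its elements would satisfy the relations between transpositions up to the central element t^2. Then
a product of such lifts that lies in the kernel is a power of t^2 determined by the number of factors;
for a product of commutators this number is 0. As the kernel is contained in the derived subgroup,
it would be trivial.

For n = 4, 5 a noncyclic abelian subgroup contains two commuting involutions, and these generate,
up to conjugation, <(1 2), (3 4)> or <(1 2)(3 4), (1 3)(2 4)>; neither has an abelian preimage.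
For n at least 6 the lifts of (1 2)(3 4) and (5 6) commute, because the same sign occurs twice.
\<close>

section \<open>Lifts of transpositions with central relations\<close>

text \<open>Maximality of a Schur cover enters only through the bound 2 <= |kernel|. The step from
  relations to elements is made by normal forms, which take the place of a presentation:
  \<open>transposition_lifts\<close> states the relations modulo a subgroup \<open>N\<close> and is
  used twice. With \<open>N\<close> the two signs, it shows that the Clifford extension is finite
  with kernel inside the signs; with \<open>N\<close> generated by (t^2, 2), it controls the kernel
  of a hypothetical cover. The obstacle there is that t^2 may be nontrivial, and relations modulo
  t^2 alone would only place the kernel among its powers; hence the integer coordinate. The class of
  t maps bijectively because the centralizer of (1 2) is <(1 2)> x Sym{3..n}: if lifts of disjoint
  transpositions commute, every lift of this centralizer commutes with t. In degrees 4 and 5 all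
  orders divide 120 = 5!, which neither 9 nor 25 divides, so only the 2-part of an abelian subgroup
  can fail to be cyclic.\<close>

abbreviation transpos :: "nat \<Rightarrow> nat \<Rightarrow> nat \<Rightarrow> nat" where
  "transpos \<equiv> Transposition.transpose"

lemma inj_comp_transpos:
  assumes "inj p"
  shows "p \<circ> transpos c d = transpos (p c) (p d) \<circ> p"
  using assms by (auto simp: fun_eq_iff Transposition.transpose_def inj_eq)

section \<open>Elementary identities in groups\<close>

lemma (in group) eq_commutatorI:
  assumes "z \<in> carrier G" "t \<in> carrier G" "u \<in> carrier G" "t \<otimes> u = z \<otimes> (u \<otimes> t)"
  shows "z = t \<otimes> u \<otimes> inv t \<otimes> inv u"
  using assms by (simp add: m_assoc)

lemma (in group) generate_commutes:
  assumes z: "z \<in> carrier G" and S: "S \<subseteq> carrier G"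
    and comm: "\<And>s. s \<in> S \<Longrightarrow> z \<otimes> s = s \<otimes> z" and x: "x \<in> generate G S"
  shows "z \<otimes> x = x \<otimes> z"
  using x
proof (induction)
  case one
  then show ?case using z by simp
next
  case (incl h)
  then show ?case using comm by blast
next
  case (inv h)
  then have h: "h \<in> carrier G" using S by blast
  have "z \<otimes> inv h = inv h \<otimes> (h \<otimes> z) \<otimes> inv h" using h z by (simp add: m_assoc[symmetric])
  also have "\<dots> = inv h \<otimes> (z \<otimes> h) \<otimes> inv h" using comm inv by simp
  also have "\<dots> = inv h \<otimes> z" using h z by (simp add: m_assoc)
  finally show ?case .
next
  case (eng g h)
  then have "g \<in> carrier G" "h \<in> carrier G" using generate_in_carrier[OF S] by blast+
  then show ?case using eng z by (metis m_assoc)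
qed

lemma (in group) inv_cancel_left:
  "\<lbrakk>g \<in> carrier G; x \<in> carrier G\<rbrakk> \<Longrightarrow> inv g \<otimes> (g \<otimes> x) = x"
  by (simp flip: m_assoc)

lemma (in group) conj_mult:
  assumes "g \<in> carrier G" "x \<in> carrier G" "y \<in> carrier G"
  shows "(g \<otimes> x \<otimes> inv g) \<otimes> (g \<otimes> y \<otimes> inv g) = g \<otimes> (x \<otimes> y) \<otimes> inv g"
  using assms by (simp add: m_assoc inv_cancel_left)

lemma (in group) conj_eqD:
  "\<lbrakk>g \<in> carrier G; x \<in> carrier G; g \<otimes> x \<otimes> inv g = y\<rbrakk> \<Longrightarrow> g \<otimes> x = y \<otimes> g"
  by (auto simp: m_assoc)

lemma (in monoid) mult_mult_swap:
  assumes "a \<in> carrier G" "b \<in> carrier G" "c \<in> carrier G" "d \<in> carrier G" "b \<otimes> c = c \<otimes> b"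
  shows "(a \<otimes> b) \<otimes> (c \<otimes> d) = (a \<otimes> c) \<otimes> (b \<otimes> d)"
proof -
  have "b \<otimes> (c \<otimes> d) = c \<otimes> (b \<otimes> d)" using assms by (metis m_assoc)
  then show ?thesis using assms(1-4) by (simp add: m_assoc)
qed

text \<open>All relations are required only up to factors in \<open>N\<close>, which commutes with
  the lifts. \<open>T a b\<close> and \<open>T b a\<close> are kept apart because the Clifford lifts
  of the two differ by a sign.\<close>

locale transposition_lifts = group G for G :: "('a, 'm) monoid_scheme" (structure) +
  fixes \<pi> :: "'a \<Rightarrow> nat \<Rightarrow> nat" and N :: "'a set" and n :: nat and T :: "nat \<Rightarrow> nat \<Rightarrow> 'a"
  assumes proj_mult: "\<lbrakk>x \<in> carrier G; y \<in> carrier G\<rbrakk> \<Longrightarrow> \<pi> (x \<otimes> y) = \<pi> x \<circ> \<pi> y"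
    and N_subgroup: "subgroup N G"
    and proj_N: "z \<in> N \<Longrightarrow> \<pi> z = id"
    and T_closed: "\<lbrakk>a \<in> {1..n}; b \<in> {1..n}; a \<noteq> b\<rbrakk> \<Longrightarrow> T a b \<in> carrier G"
    and proj_T: "\<lbrakk>a \<in> {1..n}; b \<in> {1..n}; a \<noteq> b\<rbrakk> \<Longrightarrow> \<pi> (T a b) = transpos a b"
    and N_T_comm: "\<lbrakk>z \<in> N; a \<in> {1..n}; b \<in> {1..n}; a \<noteq> b\<rbrakk> \<Longrightarrow> z \<otimes> T a b = T a b \<otimes> z"
    and T_swap: "\<lbrakk>a \<in> {1..n}; b \<in> {1..n}; a \<noteq> b\<rbrakk> \<Longrightarrow> \<exists>z\<in>N. T b a = z \<otimes> T a b"
    and T_square: "\<lbrakk>a \<in> {1..n}; b \<in> {1..n}; a \<noteq> b\<rbrakk> \<Longrightarrow> T a b \<otimes> T a b \<in> N"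
    and T_conj: "\<lbrakk>a \<in> {1..n}; b \<in> {1..n}; a \<noteq> b; c \<in> {1..n}; d \<in> {1..n}; c \<noteq> d\<rbrakk> \<Longrightarrow>
      \<exists>z\<in>N. T a b \<otimes> T c d = z \<otimes> (T (transpos a b c) (transpos a b d) \<otimes> T a b)"
begin

abbreviation lifts :: "'a set" where
  "lifts \<equiv> {T a b | a b. a \<in> {1..n} \<and> b \<in> {1..n} \<and> a \<noteq> b}"

text \<open>Normal forms along the cosets (a m+1) Sym(m) of Sym(m) in Sym(m+1).\<close>

fun lifted_sym :: "nat \<Rightarrow> 'a set" where
  "lifted_sym 0 = N"
| "lifted_sym (Suc m) = lifted_sym m \<union> {T a (Suc m) \<otimes> x | a x. a \<in> {1..m} \<and> x \<in> lifted_sym m}"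

lemma N_closed: "z \<in> N \<Longrightarrow> z \<in> carrier G"
  using N_subgroup subgroup.subset by blast

lemma lifted_sym_closed: "m \<le> n \<Longrightarrow> lifted_sym m \<subseteq> carrier G"
  by (induction m) (auto simp: N_closed intro!: m_closed T_closed)

lemma lifted_sym_N_mult: "\<lbrakk>m \<le> n; z \<in> N; x \<in> lifted_sym m\<rbrakk> \<Longrightarrow> z \<otimes> x \<in> lifted_sym m"
proof (induction m arbitrary: x)
  case 0
  then show ?case using N_subgroup by (simp add: subgroup.m_closed)
next
  case (Suc m)
  show ?case
  proof (cases "x \<in> lifted_sym m")
    case True
    then show ?thesis using Suc by simp
  next
    case False
    then obtain a y where y: "x = T a (Suc m) \<otimes> y" "a \<in> {1..m}" "y \<in> lifted_sym m"
      using Suc.prems by auto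
    have c: "T a (Suc m) \<in> carrier G" "z \<in> carrier G" "y \<in> carrier G"
      using y Suc.prems T_closed[of a "Suc m"] N_closed lifted_sym_closed[of m] by auto
    have "z \<otimes> x = T a (Suc m) \<otimes> (z \<otimes> y)"
      using y Suc.prems c N_T_comm[of z a "Suc m"] by (simp flip: m_assoc)
    then show ?thesis using y Suc by auto
  qed
qed

text \<open>Stability of the normal forms under the generators. The conjugation relation moves a
  lift past the leading coset representative; what remains is a lift in one degree less, absorbed by
  induction, and an error in \<open>N\<close>.\<close>

lemma lifted_sym_T_mult:
  "\<lbrakk>m \<le> n; a \<in> {1..m}; b \<in> {1..m}; a \<noteq> b; x \<in> lifted_sym m\<rbrakk> \<Longrightarrow> T a b \<otimes> x \<in> lifted_sym m"
proof (induction m arbitrary: a b x)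
  case 0
  then show ?case by simp
next
  case (Suc m)
  let ?M = "Suc m"
  have N_mult: "z \<otimes> u \<in> lifted_sym ?M" if "z \<in> N" "u \<in> lifted_sym ?M" for z u
    using lifted_sym_N_mult Suc.prems(1) that by blast
  have Tcl: "T i j \<in> carrier G" if "i \<in> {1..?M}" "j \<in> {1..?M}" "i \<noteq> j" for i j
    using that Suc.prems(1) by (intro T_closed) auto
  have lcl: "u \<in> carrier G" if "u \<in> lifted_sym m" for u
    using that lifted_sym_closed[of m] Suc.prems(1) by auto
  have top: "T c ?M \<otimes> u \<in> lifted_sym ?M" if c: "c \<in> {1..m}" and u: "u \<in> lifted_sym ?M" for c u
  proof (cases "u \<in> lifted_sym m")
    case True
    then show ?thesis using c by auto
  next
    case False
    then obtain d y where y: "u = T d ?M \<otimes> y" "d \<in> {1..m}" "y \<in> lifted_sym m"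
      using u by auto
    note cl = Tcl[of c ?M] Tcl[of d ?M] lcl[OF y(3)]
    show ?thesis
    proof (cases "c = d")
      case True
      have "T c ?M \<otimes> u = (T c ?M \<otimes> T c ?M) \<otimes> y"
        using y True cl c by (simp add: m_assoc)
      then show ?thesis
        using T_square[of c ?M] c Suc.prems(1) N_mult y by auto
    next
      case False
      \<comment> \<open>Two conjugations lift (c M)(d M) = (d c)(c M) = (d M)(d c), which brings the
        product to a representative (d M) followed by a transposition below M.\<close>
      obtain z1 where z1: "z1 \<in> N" "T c ?M \<otimes> T d ?M = z1 \<otimes> (T d c \<otimes> T c ?M)"
        using T_conj[of c ?M d ?M] False c y Suc.prems(1)
        by (auto simp: Transposition.transpose_def)
      obtain z2 where z2: "z2 \<in> N" "T d c \<otimes> T c ?M = z2 \<otimes> (T d ?M \<otimes> T d c)"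
        using T_conj[of d c c ?M] False c y Suc.prems(1)
        by (auto simp: Transposition.transpose_def)
      note cl' = cl Tcl[of d c] N_closed[OF z1(1)] N_closed[OF z2(1)]
      have "T c ?M \<otimes> u = (T c ?M \<otimes> T d ?M) \<otimes> y"
        using y cl c by (simp add: m_assoc)
      also have "\<dots> = z1 \<otimes> (z2 \<otimes> (T d ?M \<otimes> (T d c \<otimes> y)))"
        using z1 z2 cl' c y False by (simp add: m_assoc)
      finally have eq: "T c ?M \<otimes> u = z1 \<otimes> (z2 \<otimes> (T d ?M \<otimes> (T d c \<otimes> y)))" .
      have "T d c \<otimes> y \<in> lifted_sym m"
        using Suc.IH[of d c y] False c y Suc.prems(1) by simp
      then have "T d ?M \<otimes> (T d c \<otimes> y) \<in> lifted_sym ?M" using y(2) by auto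
      then show ?thesis unfolding eq using N_mult z1 z2 by blast
    qed
  qed
  consider "b = ?M" | "a = ?M" | "a \<in> {1..m}" "b \<in> {1..m}"
    using Suc.prems by force
  then show ?case
  proof cases
    case 1
    then show ?thesis using top[of a x] Suc.prems by auto
  next
    case 2
    obtain z where z: "z \<in> N" "T a b = z \<otimes> T b a"
      using T_swap[of b a] Suc.prems by auto
    have "x \<in> carrier G" using lifted_sym_closed Suc.prems by blast
    then have "T a b \<otimes> x = z \<otimes> (T b ?M \<otimes> x)"
      using z 2 Tcl[of b a] N_closed[OF z(1)] Suc.prems by (simp add: m_assoc)
    moreover have "T b ?M \<otimes> x \<in> lifted_sym ?M"
      using top[of b x] 2 Suc.prems by auto
    ultimately show ?thesis using N_mult z by simp
  next
    case 3
    show ?thesis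
    proof (cases "x \<in> lifted_sym m")
      case True
      then show ?thesis using Suc.IH[of a b x] 3 Suc.prems by simp
    next
      case False
      then obtain d y where y: "x = T d ?M \<otimes> y" "d \<in> {1..m}" "y \<in> lifted_sym m"
        using Suc.prems by auto
      \<comment> \<open>Since (a b) fixes M, passing it through (d M) only moves d inside
        {1..m}.\<close>
      define d' where "d' = transpos a b d"
      have d': "d' \<in> {1..m}" using 3 y by (auto simp: d'_def Transposition.transpose_def)
      obtain z where z: "z \<in> N" "T a b \<otimes> T d ?M = z \<otimes> (T d' ?M \<otimes> T a b)"
        using T_conj[of a b d ?M] Suc.prems 3 y
        by (auto simp: d'_def Transposition.transpose_def split: if_splits)
      note cl = Tcl[of d ?M] Tcl[of d' ?M] Tcl[of a b] lcl[OF y(3)] N_closed[OF z(1)]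
      have "T a b \<otimes> x = (T a b \<otimes> T d ?M) \<otimes> y"
        using y cl 3 Suc.prems by (simp add: m_assoc)
      also have "\<dots> = z \<otimes> (T d' ?M \<otimes> (T a b \<otimes> y))"
        using z cl d' 3 y Suc.prems by (simp add: m_assoc)
      finally have eq: "T a b \<otimes> x = z \<otimes> (T d' ?M \<otimes> (T a b \<otimes> y))" .
      have "T a b \<otimes> y \<in> lifted_sym m"
        using Suc.IH[of a b y] 3 Suc.prems y by simp
      then have "T d' ?M \<otimes> (T a b \<otimes> y) \<in> lifted_sym ?M" using d' by auto
      then show ?thesis unfolding eq using N_mult z by blast
    qed
  qed
qed

lemma lifted_sym_permutes: "\<lbrakk>m \<le> n; x \<in> lifted_sym m\<rbrakk> \<Longrightarrow> \<pi> x permutes {1..m}"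
proof (induction m arbitrary: x)
  case 0
  then have "\<pi> x = id" using proj_N by simp
  then show ?case by (simp only: permutes_id)
next
  case (Suc m)
  have sub: "{1..m} \<subseteq> {1..Suc m}" by auto
  show ?case
  proof (cases "x \<in> lifted_sym m")
    case True
    then show ?thesis using Suc permutes_subset[OF _ sub] by auto
  next
    case False
    then obtain a y where y: "x = T a (Suc m) \<otimes> y" "a \<in> {1..m}" "y \<in> lifted_sym m"
      using Suc.prems by auto
    have "\<pi> x = transpos a (Suc m) \<circ> \<pi> y"
      using y Suc.prems lifted_sym_closed[of m] T_closed[of a "Suc m"] proj_T[of a "Suc m"]
      by (subst y(1), subst proj_mult) auto
    moreover have "\<pi> y permutes {1..Suc m}"
      using Suc y permutes_subset[OF _ sub] by auto
    moreover have "transpos a (Suc m) permutes {1..Suc m}"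
      using y by (intro permutes_swap_id) auto
    ultimately show ?thesis using permutes_compose by metis
  qed
qed

text \<open>A leading factor \<open>T a (Suc m)\<close> would make the image send m+1 to a, as the
  rest fixes m+1. So an element over the identity has no such factor on any level and descends to
  \<open>N\<close>.\<close>

lemma lifted_sym_proj_id: "\<lbrakk>m \<le> n; x \<in> lifted_sym m; \<pi> x = id\<rbrakk> \<Longrightarrow> x \<in> N"
proof (induction m arbitrary: x)
  case 0
  then show ?case by simp
next
  case (Suc m)
  show ?case
  proof (cases "x \<in> lifted_sym m")
    case True
    then show ?thesis using Suc by auto
  next
    case False
    then obtain a y where y: "x = T a (Suc m) \<otimes> y" "a \<in> {1..m}" "y \<in> lifted_sym m"
      using Suc.prems by auto
    have "\<pi> x = transpos a (Suc m) \<circ> \<pi> y"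
      using y Suc.prems lifted_sym_closed[of m] T_closed[of a "Suc m"] proj_T[of a "Suc m"]
      by (subst y(1), subst proj_mult) auto
    moreover have "\<pi> y (Suc m) = Suc m"
      using lifted_sym_permutes[of m y] y Suc.prems by (simp add: permutes_not_in)
    ultimately have "\<pi> x (Suc m) = a" by simp
    then show ?thesis using Suc.prems y by auto
  qed
qed

lemma generate_lifts_subset: "generate G lifts \<subseteq> lifted_sym n"
proof
  have one: "\<one> \<in> lifted_sym m" for m
    using subgroup.one_closed[OF N_subgroup] by (induction m) auto
  have carr: "lifts \<subseteq> carrier G" using T_closed by auto
  have step: "g \<otimes> x \<in> lifted_sym n" if "g \<in> generate G lifts" "x \<in> lifted_sym n" for g x
    using that
  proof (induction arbitrary: x)
    case one
    then show ?case using lifted_sym_closed[of n] by auto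
  next
    case (incl h)
    then show ?case using lifted_sym_T_mult[of n] by auto
  next
    case (inv h)
    then obtain a b where h: "h = T a b" "a \<in> {1..n}" "b \<in> {1..n}" "a \<noteq> b" by auto
    have hc: "h \<in> carrier G" "x \<in> carrier G"
      using h T_closed inv.prems lifted_sym_closed[of n] by auto
    \<comment> \<open>Squares of lifts lie in \<open>N\<close>, so inverting a generator costs only
      a factor in \<open>N\<close>.\<close>
    have "inv h \<otimes> x = inv (h \<otimes> h) \<otimes> (h \<otimes> x)"
      using hc by (simp add: inv_mult_group m_assoc flip: m_assoc[of "inv h" h x])
    moreover have "inv (h \<otimes> h) \<in> N"
      using T_square h subgroup.m_inv_closed[OF N_subgroup] by auto
    moreover have "h \<otimes> x \<in> lifted_sym n"
      using lifted_sym_T_mult[of n a b x] h inv.prems by auto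
    ultimately show ?case using lifted_sym_N_mult[of n] by simp
  next
    case (eng g h)
    have "g \<in> carrier G" "h \<in> carrier G" "x \<in> carrier G"
      using eng generate_in_carrier[OF carr] lifted_sym_closed[of n] by auto
    then show ?case using eng by (simp add: m_assoc)
  qed
  fix g assume g: "g \<in> generate G lifts"
  then have "g \<in> carrier G" using generate_in_carrier[OF carr] by blast
  then show "g \<in> lifted_sym n" using step[OF g one[of n]] by simp
qed

text \<open>The substitute for a presentation of the symmetric group: relations modulo
  \<open>N\<close> between the lifts already force every word over the identity into
  \<open>N\<close>.\<close>

theorem generate_lifts_proj_id: "\<lbrakk>g \<in> generate G lifts; \<pi> g = id\<rbrakk> \<Longrightarrow> g \<in> N"
  using generate_lifts_subset lifted_sym_proj_id by blast

lemma finite_generate_lifts: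
  assumes "finite N"
  shows "finite (generate G lifts)"
proof -
  have "finite (lifted_sym m)" for m
  proof (induction m)
    case (Suc m)
    have "{T a (Suc m) \<otimes> x | a x. a \<in> {1..m} \<and> x \<in> lifted_sym m}
      = (\<lambda>(a, x). T a (Suc m) \<otimes> x) ` ({1..m} \<times> lifted_sym m)" by fast
    then show ?case using Suc by simp
  qed (use assms in simp)
  then show ?thesis using generate_lifts_subset finite_subset by blast
qed

lemma generate_lifts_surj:
  assumes "p permutes {1..n}"
  shows "\<exists>g \<in> generate G lifts. \<pi> g = p"
  using assms finite_atLeastAtMost
proof (induction rule: permutes_induct)
  case id
  have "\<pi> \<one> = id" using subgroup.one_closed[OF N_subgroup] proj_N by blast
  then show ?case using generate.one by blast
next
  case (swap a b p)
  then obtain g where g: "g \<in> generate G lifts" "\<pi> g = p" by blast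
  have T: "T a b \<in> generate G lifts" using swap by (intro generate.incl) blast
  have carr: "lifts \<subseteq> carrier G" using T_closed by auto
  have "\<pi> (T a b \<otimes> g) = transpos a b \<circ> p"
    using g swap proj_T generate_in_carrier[OF carr] T by (simp add: proj_mult)
  then show ?case using generate.eng[OF T g(1)] by blast
qed

end

section \<open>A stem extension with kernel of order 2\<close>

type_synonym spinor = "nat set \<Rightarrow> real"

text \<open>Left multiplication by the Clifford generator e_i on coordinates with respect to the products e_S,
  up to relabelling. Infinite S are harmless, since {j \<in> S. j < i} is always finite.\<close>

definition clifford :: "nat \<Rightarrow> spinor \<Rightarrow> spinor" where
  "clifford i f = (\<lambda>S. (-1) ^ card {j \<in> S. j < i} * f (sym_diff S {i}))"

text \<open>The sign counts elements strictly below i, and toggling i does not change them, so the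
  same sign occurs twice.\<close>

lemma clifford_square: "clifford i (clifford i f) = f"
proof -
  have "{j \<in> sym_diff S {i}. j < i} = {j \<in> S. j < i}" for S by auto
  moreover have "sym_diff (sym_diff S {i}) {i} = S" for S :: "nat set" by auto
  ultimately show ?thesis
    by (simp add: clifford_def fun_eq_iff flip: mult.assoc power_mult_distrib power_add)
qed

text \<open>Toggling j leaves the elements below i alone, while toggling i changes the number of
  elements below j by one. Exactly one of the two signs flips.\<close>

lemma clifford_anticomm_less:
  assumes "i < j"
  shows "clifford j (clifford i f) S = - clifford i (clifford j f) S"
proof -
  have 1: "{k \<in> sym_diff S {j}. k < i} = {k \<in> S. k < i}" using assms by auto
  have 2: "sym_diff (sym_diff S {j}) {i} = sym_diff (sym_diff S {i}) {j}" by auto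
  let ?A = "{k \<in> S. k < j}"
  have fin: "finite ?A" by simp
  have "(-1::real) ^ card {k \<in> sym_diff S {i}. k < j} = - ((-1) ^ card ?A)"
  proof (cases "i \<in> S")
    case True
    then have "?A = insert i {k \<in> sym_diff S {i}. k < j}" "i \<notin> {k \<in> sym_diff S {i}. k < j}"
      using assms by auto
    then have "card ?A = Suc (card {k \<in> sym_diff S {i}. k < j})"
      using fin by (metis card_insert_disjoint finite_insert)
    then show ?thesis by simp
  next
    case False
    then have "{k \<in> sym_diff S {i}. k < j} = insert i ?A" "i \<notin> ?A" using assms by auto
    then show ?thesis using fin by simp
  qed
  then show ?thesis using 1 2 by (simp add: clifford_def)
qed

lemma clifford_anticomm:
  "i \<noteq> j \<Longrightarrow> clifford i (clifford j f) S = - clifford j (clifford i f) S"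
  using clifford_anticomm_less[of i j f S] clifford_anticomm_less[of j i f S] by linarith

text \<open>The vector e_a - e_b is normal to the hyperplane x_a = x_b, whose reflection is the
  transposition (a b). For distinct a and b it squares to 2, which explains the
  normalization.\<close>

definition reflection :: "nat \<Rightarrow> nat \<Rightarrow> spinor \<Rightarrow> spinor" where
  "reflection a b f = (\<lambda>S. (clifford a f S - clifford b f S) / sqrt 2)"

lemma reflection_reflection:
  "reflection a b (reflection c d f) S =
    (clifford a (clifford c f) S - clifford a (clifford d f) S
      - clifford b (clifford c f) S + clifford b (clifford d f) S) / 2"
  by (simp add: reflection_def clifford_def field_simps)

lemma reflection_square:
  assumes "a \<noteq> b"
  shows "reflection a b (reflection a b f) = f"
  using clifford_anticomm[OF assms, of f]
  by (auto simp: fun_eq_iff reflection_reflection clifford_square)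

text \<open>For a unit vector u, Clifford multiplication satisfies u v u = -v', where v' is the
  mirror image of v in the hyperplane normal to u. Here that mirror exchanges the coordinates a and
  b. The case split lists how {c, d} can meet {a, b}.\<close>

lemma reflection_conj:
  assumes "a \<noteq> b" "c \<noteq> d"
  shows "reflection a b (reflection c d f) S =
    - reflection (transpos a b c) (transpos a b d) (reflection a b f) S"
proof -
  note ac = clifford_anticomm[of _ _ f S]
  consider "c = a" "d = b" | "c = b" "d = a" | "c = a" "d \<notin> {a, b}" | "c = b" "d \<notin> {a, b}"
    | "d = a" "c \<notin> {a, b}" | "d = b" "c \<notin> {a, b}" | "c \<notin> {a, b}" "d \<notin> {a, b}"
    using assms by blast
  then show ?thesis
    using assms
    by cases (use ac[of a b] ac[of a c] ac[of a d] ac[of b c] ac[of b d] in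
      \<open>simp_all add: reflection_reflection clifford_square field_simps\<close>)
qed

lemma reflection_swap: "reflection b a f S = - reflection a b f S"
  by (simp add: reflection_def field_simps)

lemma bij_reflection: "a \<noteq> b \<Longrightarrow> bij (reflection a b)"
  by (rule o_bij[of "reflection a b"]) (auto simp: fun_eq_iff reflection_square)

definition spinor_neg :: "spinor \<Rightarrow> spinor" where
  "spinor_neg f = (\<lambda>S. - f S)"

lemma spinor_neg_neg: "spinor_neg \<circ> spinor_neg = id"
  by (auto simp: spinor_neg_def)

lemma bij_spinor_neg: "bij spinor_neg"
  using o_bij spinor_neg_neg by blast

lemma spinor_neg_ne_id: "spinor_neg \<noteq> id"
proof
  assume "spinor_neg = id"
  then have "spinor_neg (\<lambda>_. 1) {} = 1" by simp
  then show False by (simp add: spinor_neg_def)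
qed

lemma reflection_neg: "reflection a b \<circ> spinor_neg = spinor_neg \<circ> reflection a b"
  by (auto simp: fun_eq_iff reflection_def spinor_neg_def clifford_def field_simps)

text \<open>Each operator carries its permutation along, so that the covering map is simply
  \<open>snd\<close>.\<close>

abbreviation spinor_perm :: "nat \<Rightarrow> ((spinor \<Rightarrow> spinor) \<times> (nat \<Rightarrow> nat)) monoid" where
  "spinor_perm n \<equiv> BijGroup UNIV \<times>\<times> sym_group n"

definition reflection_lift :: "nat \<Rightarrow> nat \<Rightarrow> (spinor \<Rightarrow> spinor) \<times> (nat \<Rightarrow> nat)" where
  "reflection_lift a b = (reflection a b, transpos a b)"

abbreviation signs :: "((spinor \<Rightarrow> spinor) \<times> (nat \<Rightarrow> nat)) set" where
  "signs \<equiv> {(id, id), (spinor_neg, id)}"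

lemma group_spinor_perm: "group (spinor_perm n)"
  by (simp add: DirProd_group group_BijGroup sym_group_is_group)

lemma carrier_spinor_perm: "(f, p) \<in> carrier (spinor_perm n) \<longleftrightarrow> bij f \<and> p permutes {1..n}"
  by (auto simp: BijGroup_def Bij_def sym_group_carrier)

lemma one_spinor_perm: "\<one>\<^bsub>spinor_perm n\<^esub> = (id, id)"
  by (auto simp: BijGroup_def sym_group_one)

lemma mult_spinor_perm:
  "\<lbrakk>bij f; bij g\<rbrakk> \<Longrightarrow> (f, p) \<otimes>\<^bsub>spinor_perm n\<^esub> (g, q) = (f \<circ> g, p \<circ> q)"
  by (auto simp: BijGroup_def Bij_def sym_group_mult compose_def)

lemma subgroup_signs: "subgroup signs (spinor_perm n)"
proof -
  interpret group "spinor_perm n" by (rule group_spinor_perm)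
  have neg2: "(spinor_neg, id) \<otimes>\<^bsub>spinor_perm n\<^esub> (spinor_neg, id) = (id, id)"
    by (simp add: mult_spinor_perm bij_spinor_neg spinor_neg_neg del: mult_DirProd)
  have mem: "(spinor_neg, id) \<in> carrier (spinor_perm n)"
    by (simp add: carrier_spinor_perm bij_spinor_neg permutes_id del: carrier_DirProd)
  have one: "(id, id) \<in> carrier (spinor_perm n)"
    using one_closed unfolding one_spinor_perm .
  have inv_neg: "inv\<^bsub>spinor_perm n\<^esub> (spinor_neg, id) = (spinor_neg, id)"
    using inv_equality[OF _ mem mem] neg2 unfolding one_spinor_perm .
  have inv_id: "inv\<^bsub>spinor_perm n\<^esub> (id, id) = (id, id)"
    using inv_one unfolding one_spinor_perm .
  have id_l: "(id, id) \<otimes>\<^bsub>spinor_perm n\<^esub> x = x" and id_r: "x \<otimes>\<^bsub>spinor_perm n\<^esub> (id, id) = x"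
    if "x \<in> carrier (spinor_perm n)" for x
    using l_one[OF that] r_one[OF that] unfolding one_spinor_perm by blast+
  show ?thesis
  proof (rule subgroupI)
    show "signs \<subseteq> carrier (spinor_perm n)" using one mem by blast
    show "signs \<noteq> {}" by blast
    fix x assume x: "x \<in> signs"
    then show "inv\<^bsub>spinor_perm n\<^esub> x \<in> signs" using inv_neg inv_id by (elim insertE) (simp_all only:, blast+)
    fix y assume y: "y \<in> signs"
    consider "x = (id, id)" | "y = (id, id)" | "x = (spinor_neg, id)" "y = (spinor_neg, id)"
      using x y by blast
    then show "x \<otimes>\<^bsub>spinor_perm n\<^esub> y \<in> signs"
    proof cases
      case 1
      have "y \<in> carrier (spinor_perm n)" using y one mem by blast
      then show ?thesis unfolding 1 using id_l y by metis
    next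
      case 2
      have "x \<in> carrier (spinor_perm n)" using x one mem by blast
      then show ?thesis unfolding 2 using id_r x by metis
    next
      case 3
      then show ?thesis using neg2 by (simp only:) blast
    qed
  qed
qed

lemma transposition_lifts_reflection:
  "transposition_lifts (spinor_perm n) snd signs n reflection_lift"
proof -
  interpret group "spinor_perm n" by (rule group_spinor_perm)
  show ?thesis
  proof (intro transposition_lifts.intro transposition_lifts_axioms.intro is_group)
    fix x y :: "(spinor \<Rightarrow> spinor) \<times> (nat \<Rightarrow> nat)" assume "x \<in> carrier (spinor_perm n)" "y \<in> carrier (spinor_perm n)"
    then show "snd (x \<otimes>\<^bsub>spinor_perm n\<^esub> y) = snd x \<circ> snd y"
      by (cases x; cases y) (simp add: sym_group_mult)
  next
    show "subgroup signs (spinor_perm n)" by (rule subgroup_signs)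
  next
    fix z :: "(spinor \<Rightarrow> spinor) \<times> (nat \<Rightarrow> nat)" assume "z \<in> signs"
    then show "snd z = id" by auto
  next
    fix a b :: nat assume "a \<in> {1..n}" "b \<in> {1..n}" "a \<noteq> b"
    then show "reflection_lift a b \<in> carrier (spinor_perm n)"
      unfolding reflection_lift_def carrier_spinor_perm by (simp add: bij_reflection permutes_swap_id)
  next
    fix a b :: nat show "snd (reflection_lift a b) = transpos a b" by (simp add: reflection_lift_def)
  next
    fix z and a b :: nat assume "z \<in> signs" "a \<noteq> b"
    then show "z \<otimes>\<^bsub>spinor_perm n\<^esub> reflection_lift a b = reflection_lift a b \<otimes>\<^bsub>spinor_perm n\<^esub> z"
      unfolding reflection_lift_def
      by (auto simp: mult_spinor_perm bij_reflection bij_spinor_neg reflection_neg simp del: mult_DirProd)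
  next
    fix a b :: nat assume "a \<noteq> b"
    then have "reflection_lift b a = (spinor_neg, id) \<otimes>\<^bsub>spinor_perm n\<^esub> reflection_lift a b"
      unfolding reflection_lift_def
      by (auto simp: mult_spinor_perm bij_reflection bij_spinor_neg fun_eq_iff spinor_neg_def
          reflection_swap[of b a] transpose_commute simp del: mult_DirProd)
    then show "\<exists>z \<in> signs.
        reflection_lift b a = z \<otimes>\<^bsub>spinor_perm n\<^esub> reflection_lift a b" by blast
  next
    fix a b :: nat assume "a \<noteq> b"
    then show "reflection_lift a b \<otimes>\<^bsub>spinor_perm n\<^esub> reflection_lift a b
        \<in> signs"
      unfolding reflection_lift_def
      by (auto simp: mult_spinor_perm bij_reflection fun_eq_iff reflection_square simp del: mult_DirProd)
  next
    fix a b c d :: nat assume ne: "a \<noteq> b" "c \<noteq> d"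
    have bij: "bij (reflection (transpos a b c) (transpos a b d))"
      using ne bij_reflection transpose_eq_imp_eq by metis
    have "reflection_lift a b \<otimes>\<^bsub>spinor_perm n\<^esub> reflection_lift c d =
        (reflection a b \<circ> reflection c d, transpos a b \<circ> transpos c d)"
      using ne unfolding reflection_lift_def by (simp add: mult_spinor_perm bij_reflection del: mult_DirProd)
    also have "reflection a b \<circ> reflection c d =
        spinor_neg \<circ> (reflection (transpos a b c) (transpos a b d) \<circ> reflection a b)"
      using reflection_conj[OF ne] by (auto simp: fun_eq_iff spinor_neg_def)
    also have "transpos a b \<circ> transpos c d = id \<circ> (transpos (transpos a b c) (transpos a b d) \<circ> transpos a b)"
      using inj_comp_transpos[of "transpos a b" c d] by simp
    also have "(spinor_neg \<circ> (reflection (transpos a b c) (transpos a b d) \<circ> reflection a b),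
        id \<circ> (transpos (transpos a b c) (transpos a b d) \<circ> transpos a b)) = 
        (spinor_neg, id) \<otimes>\<^bsub>spinor_perm n\<^esub> (reflection_lift (transpos a b c) (transpos a b d)
          \<otimes>\<^bsub>spinor_perm n\<^esub> reflection_lift a b)"
      unfolding reflection_lift_def
        mult_spinor_perm[OF bij bij_reflection[OF ne(1)]]
        mult_spinor_perm[OF bij_spinor_neg bij_comp[OF bij_reflection[OF ne(1)] bij]] ..
    finally show "\<exists>z \<in> signs.
        reflection_lift a b \<otimes>\<^bsub>spinor_perm n\<^esub> reflection_lift c d =
        z \<otimes>\<^bsub>spinor_perm n\<^esub> (reflection_lift (transpos a b c) (transpos a b d)
          \<otimes>\<^bsub>spinor_perm n\<^esub> reflection_lift a b)" by blast
  qed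
qed

section \<open>The double cover generated by the reflections\<close>

definition spin_cover :: "nat \<Rightarrow> ((spinor \<Rightarrow> spinor) \<times> (nat \<Rightarrow> nat)) monoid" where
  "spin_cover n = (spinor_perm n)\<lparr>carrier := generate (spinor_perm n)
     {reflection_lift a b | a b. a \<in> {1..n} \<and> b \<in> {1..n} \<and> a \<noteq> b}\<rparr>"

text \<open>Normal forms give finiteness and confine the kernel to the signs. That the sign -1
  occurs at all, and lies in the derived subgroup, comes from writing it as one commutator; its
  centrality is checked on the generators.\<close>

theorem spin_cover_stem_extension:
  assumes "4 \<le> n"
  shows "stem_extension (sym_group n) (spin_cover n) snd"
    and "finite (carrier (spin_cover n))"
    and "2 \<le> card (kernel (spin_cover n) (sym_group n) snd)"
proof -
  interpret transposition_lifts "spinor_perm n" snd "signs" n reflection_lift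
    by (rule transposition_lifts_reflection)
  let ?S = "{reflection_lift a b | a b. a \<in> {1..n} \<and> b \<in> {1..n} \<and> a \<noteq> b}"
  let ?K = "generate (spinor_perm n) ?S"
  have carr: "?S \<subseteq> carrier (spinor_perm n)" using T_closed by blast
  have sub: "subgroup ?K (spinor_perm n)" by (rule generate_is_subgroup[OF carr])
  have cK: "carrier (spin_cover n) = ?K" and mK: "monoid.mult (spin_cover n) = monoid.mult (spinor_perm n)"
    by (simp_all add: spin_cover_def)
  have grp: "group (spin_cover n)"
    unfolding spin_cover_def by (rule subgroup_imp_group[OF sub])
  show fin: "finite (carrier (spin_cover n))"
    unfolding cK by (rule finite_generate_lifts) simp
  have Kc: "x \<in> carrier (spinor_perm n)" if "x \<in> ?K" for x
    using that subgroup.mem_carrier[OF sub] by blast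
  have perm: "snd x permutes {1..n}" if "x \<in> ?K" for x
    using Kc[OF that] carrier_spinor_perm by (metis prod.collapse)
  have hom: "snd \<in> hom (spin_cover n) (sym_group n)"
    using perm Kc proj_mult unfolding hom_def cK mK by (auto simp: sym_group_carrier sym_group_mult)
  have epi: "snd \<in> epi (spin_cover n) (sym_group n)"
    unfolding epi_def using hom hom_in_carrier[OF hom] generate_lifts_surj
    by (fastforce simp: cK sym_group_carrier)
  have ker: "kernel (spin_cover n) (sym_group n) snd \<subseteq> signs"
    using generate_lifts_proj_id unfolding kernel_def cK sym_group_one by blast
  have neg_c: "(spinor_neg, id) \<in> carrier (spinor_perm n)"
    using subgroup.mem_carrier[OF subgroup_signs] by blast
  have ne: "(1::nat) \<noteq> 2" "(3::nat) \<noteq> 4" by auto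
  define t where "t = reflection_lift 1 2"
  define u where "u = reflection_lift 3 4"
  have tu: "t \<in> ?S" "u \<in> ?S" using assms unfolding t_def u_def by fastforce+
  then have tuK: "t \<in> ?K" "u \<in> ?K" by (auto intro: generate.incl)
  note tuc = Kc[OF tuK(1)] Kc[OF tuK(2)]
  \<comment> \<open>(1 2) fixes 3 and 4, so conjugation changes only the sign of the second
    reflection. The four points explain the bound on n.\<close>
  have "reflection 1 2 \<circ> reflection 3 4 = spinor_neg \<circ> (reflection 3 4 \<circ> reflection 1 2)"
    using reflection_conj[OF ne] by (auto simp: fun_eq_iff spinor_neg_def)
  moreover have "transpos 1 2 \<circ> transpos 3 4 = transpos 3 4 \<circ> transpos 1 2"
    by (auto simp: fun_eq_iff Transposition.transpose_def)
  moreover have "bij (reflection 1 2)" "bij (reflection 3 4)"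
    using bij_reflection ne by blast+
  ultimately have tu_comm: "t \<otimes>\<^bsub>spinor_perm n\<^esub> u =
      (spinor_neg, id) \<otimes>\<^bsub>spinor_perm n\<^esub> (u \<otimes>\<^bsub>spinor_perm n\<^esub> t)"
    unfolding t_def u_def reflection_lift_def
    by (metis mult_spinor_perm bij_spinor_neg bij_comp comp_id id_comp)
  have neg_eq: "(spinor_neg, id) = t \<otimes>\<^bsub>spinor_perm n\<^esub> u \<otimes>\<^bsub>spinor_perm n\<^esub> inv\<^bsub>spinor_perm n\<^esub> t
      \<otimes>\<^bsub>spinor_perm n\<^esub> inv\<^bsub>spinor_perm n\<^esub> u"
    by (rule eq_commutatorI[OF neg_c tuc tu_comm])
  have "(spinor_neg, id) \<in> derived_set (spinor_perm n) ?K"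
    using tuK neg_eq by blast
  then have "(spinor_neg, id) \<in> derived (spinor_perm n) ?K"
    unfolding derived_def by (rule generate.incl)
  moreover have der: "derived (spin_cover n) (carrier (spin_cover n)) = derived (spinor_perm n) ?K"
    unfolding cK unfolding spin_cover_def by (rule derived_consistent[OF order_refl sub])
  ultimately have neg_der: "(spinor_neg, id) \<in> derived (spin_cover n) (carrier (spin_cover n))"
    by (simp only:)
  have one_der: "(id, id) \<in> derived (spin_cover n) (carrier (spin_cover n))"
    unfolding der unfolding derived_def by (rule generate.one[of "spinor_perm n", unfolded one_spinor_perm])
  have neg_K: "(spinor_neg, id) \<in> ?K"
    using derived_incl[OF order_refl sub] neg_der unfolding der by blast
  have one_K: "(id, id) \<in> ?K"
    by (rule generate.one[of "spinor_perm n", unfolded one_spinor_perm])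
  have comm: "(spinor_neg, id) \<otimes>\<^bsub>spinor_perm n\<^esub> x = x \<otimes>\<^bsub>spinor_perm n\<^esub> (spinor_neg, id)"
    if "x \<in> ?K" for x
    using generate_commutes[OF neg_c carr _ that] N_T_comm by blast
  have center: "signs \<subseteq> grp_center (spin_cover n)"
  proof -
    have "(id, id) \<otimes>\<^bsub>spinor_perm n\<^esub> x = x \<otimes>\<^bsub>spinor_perm n\<^esub> (id, id)" if "x \<in> ?K" for x
      using l_one[OF Kc[OF that]] r_one[OF Kc[OF that]] unfolding one_spinor_perm by metis
    then show ?thesis
      using comm neg_K one_K unfolding grp_center_def cK mK by blast
  qed
  show "stem_extension (sym_group n) (spin_cover n) snd"
    unfolding stem_extension_def
    using sym_group_is_group grp epi ker center neg_der one_der by blast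
  have "signs \<subseteq> kernel (spin_cover n) (sym_group n) snd"
    using neg_K one_K unfolding kernel_def cK sym_group_one by auto
  moreover have "card signs = 2"
    using spinor_neg_ne_id by auto
  moreover have "finite (kernel (spin_cover n) (sym_group n) snd)"
    using ker finite_subset by blast
  ultimately show "2 \<le> card (kernel (spin_cover n) (sym_group n) snd)"
    using card_mono by metis
qed

section \<open>Commuting lifts in a stem extension\<close>

text \<open>High transitivity of the symmetric group, used to conjugate transpositions, and pairs of
  disjoint ones, into any position. The induction corrects p by a swap of \<open>p x\<close> and y,
  neither of which occurs in \<open>ys\<close>.\<close>

lemma permutes_map_list:
  fixes xs :: "nat list"
  assumes "distinct xs" "distinct ys" "length xs = length ys" "set xs \<subseteq> A" "set ys \<subseteq> A"
  shows "\<exists>p. p permutes A \<and> map p xs = ys"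
  using assms(3,1,2,4,5)
proof (induction xs ys rule: list_induct2)
  case Nil
  then show ?case using permutes_id by (metis list.map(1))
next
  case (Cons x xs y ys)
  then obtain p where p: "p permutes A" "map p xs = ys" by auto
  have px: "p x \<notin> set ys" "p x \<in> A"
    using Cons.prems p permutes_in_image[OF p(1)] permutes_inj[OF p(1)] by (auto simp: inj_eq)
  have "transpos (p x) y \<circ> p permutes A"
    using p px Cons.prems by (intro permutes_compose permutes_swap_id) auto
  moreover have "map (transpos (p x) y \<circ> p) xs = ys"
  proof -
    have "map (transpos (p x) y) ys = ys"
      by (rule map_idI) (metis Cons.prems(2) distinct.simps(2) px(1) transpose_apply_other)
    then show ?thesis using p(2) by (metis map_map)
  qed
  moreover have "(transpos (p x) y \<circ> p) x = y" by simp
  ultimately show ?case by (metis list.map(2))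
qed

lemma conj_transpos:
  assumes "g permutes A"
  shows "g \<circ> transpos a b \<circ> inv' g = transpos (g a) (g b)"
  using inj_comp_transpos[OF permutes_inj[OF assms], of a b] permutes_inv_o(1)[OF assms]
  by (simp add: comp_assoc)

section \<open>Pairs of permutations with commuting lifts\<close>

locale sym_stem_extension = group H for H :: "('b, 'c) monoid_scheme" (structure) +
  fixes n :: nat and \<pi> :: "'b \<Rightarrow> nat \<Rightarrow> nat"
  assumes stem: "stem_extension (sym_group n) H \<pi>"
begin

lemma proj_epi: "\<pi> \<in> epi H (sym_group n)"
  using stem unfolding stem_extension_def by blast

lemma proj_permutes: "x \<in> carrier H \<Longrightarrow> \<pi> x permutes {1..n}"
  using proj_epi by (auto simp: epi_def hom_def sym_group_carrier Pi_iff)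

lemma proj_mult: "\<lbrakk>x \<in> carrier H; y \<in> carrier H\<rbrakk> \<Longrightarrow> \<pi> (x \<otimes> y) = \<pi> x \<circ> \<pi> y"
  using proj_epi by (auto simp: epi_def hom_def sym_group_mult)

lemma proj_surj: "p permutes {1..n} \<Longrightarrow> \<exists>x \<in> carrier H. \<pi> x = p"
  using proj_epi unfolding epi_def by (metis (mono_tags, lifting) imageE mem_Collect_eq sym_group_carrier)

lemma proj_group_hom: "group_hom H (sym_group n) \<pi>"
  using proj_epi by (simp add: group_hom_def group_hom_axioms_def epi_def is_group sym_group_is_group)

lemma proj_one: "\<pi> \<one> = id"
proof -
  have "\<pi> \<one> = \<pi> \<one> \<circ> \<pi> \<one>" using proj_mult[of \<one> \<one>] by simp
  then show ?thesis
    using permutes_inv_o(1)[OF proj_permutes[OF one_closed]] by (metis comp_assoc comp_id)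
qed

lemma proj_inv: "x \<in> carrier H \<Longrightarrow> \<pi> (inv x) = inv' (\<pi> x)"
  using proj_mult[of "inv x" x] proj_one by (simp add: inv_unique_comp[symmetric] permutes_inv_o proj_permutes)
    (metis comp_assoc comp_id id_comp permutes_inv_o(1) proj_permutes)

lemma kernel_commutes: "\<lbrakk>z \<in> carrier H; \<pi> z = id; y \<in> carrier H\<rbrakk> \<Longrightarrow> z \<otimes> y = y \<otimes> z"
  using stem unfolding stem_extension_def kernel_def grp_center_def sym_group_one by blast

lemma kernel_derived: "\<lbrakk>z \<in> carrier H; \<pi> z = id\<rbrakk> \<Longrightarrow> z \<in> derived H (carrier H)"
  using stem unfolding stem_extension_def kernel_def sym_group_one by blast

lemma same_proj:
  assumes "x \<in> carrier H" "y \<in> carrier H" "\<pi> x = \<pi> y"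
  obtains z where "z \<in> carrier H" "\<pi> z = id" "y = z \<otimes> x"
proof
  show "y \<otimes> inv x \<in> carrier H" using assms by simp
  show "\<pi> (y \<otimes> inv x) = id"
    using assms proj_mult proj_inv permutes_inv_o(1)[OF proj_permutes] by simp
  show "y = y \<otimes> inv x \<otimes> x" using assms by (simp add: m_assoc)
qed

definition lifts_commute :: "(nat \<Rightarrow> nat) \<Rightarrow> (nat \<Rightarrow> nat) \<Rightarrow> bool" where
  "lifts_commute p q \<longleftrightarrow>
     (\<forall>x \<in> carrier H. \<forall>y \<in> carrier H. \<pi> x = p \<and> \<pi> y = q \<longrightarrow> x \<otimes> y = y \<otimes> x)"

lemma lifts_commuteD:
  "\<lbrakk>lifts_commute (\<pi> x) (\<pi> y); x \<in> carrier H; y \<in> carrier H\<rbrakk> \<Longrightarrow> x \<otimes> y = y \<otimes> x"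
  unfolding lifts_commute_def by blast

text \<open>One commuting pair of lifts decides: all other lifts differ from it by kernel elements,
  which are central and can be collected in front.\<close>

lemma lifts_commuteI:
  assumes "x \<in> carrier H" "y \<in> carrier H" "x \<otimes> y = y \<otimes> x"
  shows "lifts_commute (\<pi> x) (\<pi> y)"
  unfolding lifts_commute_def
proof (intro ballI impI)
  fix x' y' assume xy': "x' \<in> carrier H" "y' \<in> carrier H" "\<pi> x' = \<pi> x \<and> \<pi> y' = \<pi> y"
  obtain z where z: "z \<in> carrier H" "\<pi> z = id" "x' = z \<otimes> x"
    using same_proj[of x x'] assms xy' by auto
  obtain w where w: "w \<in> carrier H" "\<pi> w = id" "y' = w \<otimes> y"
    using same_proj[of y y'] assms xy' by auto
  have "z \<otimes> x \<otimes> (w \<otimes> y) = z \<otimes> w \<otimes> (x \<otimes> y)"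
    using z w assms kernel_commutes[OF w(1,2), of x] mult_mult_swap[of z x w y] by simp
  also have "\<dots> = w \<otimes> z \<otimes> (y \<otimes> x)"
    using assms kernel_commutes[OF w(1,2) z(1)] by simp
  also have "\<dots> = w \<otimes> y \<otimes> (z \<otimes> x)"
    using z w assms kernel_commutes[OF z(1,2), of y] mult_mult_swap[of w z y x] by simp
  finally show "x' \<otimes> y' = y' \<otimes> x'" using z w by simp
qed

lemma lifts_commute_sym: "lifts_commute p q \<Longrightarrow> lifts_commute q p"
  unfolding lifts_commute_def by metis

lemma lifts_commute_refl: "p permutes {1..n} \<Longrightarrow> lifts_commute p p"
  using proj_surj lifts_commuteI by metis

lemma lifts_commute_id: "q permutes {1..n} \<Longrightarrow> lifts_commute id q"
  using lifts_commuteI[OF one_closed] proj_one proj_surj l_one r_one by metis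

lemma lifts_commute_comp:
  assumes "lifts_commute p q" "lifts_commute p' q"
    and "p permutes {1..n}" "p' permutes {1..n}" "q permutes {1..n}"
  shows "lifts_commute (p \<circ> p') q"
proof -
  obtain x x' y where l: "x \<in> carrier H" "\<pi> x = p" "x' \<in> carrier H" "\<pi> x' = p'" "y \<in> carrier H" "\<pi> y = q"
    using assms proj_surj by metis
  then have "x \<otimes> y = y \<otimes> x" "x' \<otimes> y = y \<otimes> x'" using assms lifts_commuteD by auto
  then have "(x \<otimes> x') \<otimes> y = y \<otimes> (x \<otimes> x')" using l by (metis m_assoc)
  then show ?thesis using l lifts_commuteI[of "x \<otimes> x'" y] proj_mult by simp
qed

lemma lifts_commute_conj:
  assumes "lifts_commute p q" "g permutes {1..n}" "p permutes {1..n}" "q permutes {1..n}"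
  shows "lifts_commute (g \<circ> p \<circ> inv' g) (g \<circ> q \<circ> inv' g)"
proof -
  obtain x y h where l: "x \<in> carrier H" "\<pi> x = p" "y \<in> carrier H" "\<pi> y = q" "h \<in> carrier H" "\<pi> h = g"
    using assms proj_surj by metis
  then have xy: "x \<otimes> y = y \<otimes> x" using assms lifts_commuteD by auto
  have "\<pi> (h \<otimes> x \<otimes> inv h) = g \<circ> p \<circ> inv' g" "\<pi> (h \<otimes> y \<otimes> inv h) = g \<circ> q \<circ> inv' g"
    using l by (simp_all add: proj_mult proj_inv)
  then show ?thesis
    using lifts_commuteI[of "h \<otimes> x \<otimes> inv h" "h \<otimes> y \<otimes> inv h"] conj_mult[of h x y] conj_mult[of h y x] l xy by simp
qed

lemma lifts_commute_generate:
  assumes S: "S \<subseteq> carrier (sym_group n)" and q: "q permutes {1..n}"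
    and comm: "\<And>s. s \<in> S \<Longrightarrow> lifts_commute s q" and p: "p \<in> generate (sym_group n) S"
  shows "lifts_commute p q"
proof -
  interpret S: group "sym_group n" by (rule sym_group_is_group)
  obtain y where y: "y \<in> carrier H" "\<pi> y = q" using q proj_surj by blast
  have inv: "lifts_commute (inv\<^bsub>sym_group n\<^esub> s) q" if s: "s \<in> S" for s
  proof -
    obtain x where x: "x \<in> carrier H" "\<pi> x = s" using s S proj_surj sym_group_carrier by blast
    have "x \<otimes> y = y \<otimes> x" using comm[OF s] x y lifts_commuteD by blast
    then have "inv x \<otimes> y = y \<otimes> inv x"
      using x y by (metis inv_closed inv_solve_left inv_solve_right m_assoc m_closed)
    then show ?thesis
      using lifts_commuteI[of "inv x" y] x y group_hom.hom_inv[OF proj_group_hom x(1)] by simp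
  qed
  show ?thesis
    using p
  proof (induction)
    case one
    then show ?case using lifts_commute_id q by (simp only: sym_group_one)
  next
    case (eng g h)
    then have "g permutes {1..n}" "h permutes {1..n}"
      using S.generate_in_carrier[OF S] by (auto simp: sym_group_carrier)
    then show ?case using eng lifts_commute_comp q unfolding sym_group_mult by blast
  qed (use comm inv in blast)+
qed

lemma lifts_commute_transpos:
  assumes "lifts_commute (transpos a b) (transpos c d)"
    and "distinct [a, b, c, d]" "{a, b, c, d} \<subseteq> {1..n}"
    and "distinct [a', b', c', d']" "{a', b', c', d'} \<subseteq> {1..n}"
  shows "lifts_commute (transpos a' b') (transpos c' d')"
proof -
  obtain g where g: "g permutes {1..n}" "map g [a, b, c, d] = [a', b', c', d']"
    using permutes_map_list[of "[a, b, c, d]" "[a', b', c', d']" "{1..n}"] assms by auto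
  have "transpos a b permutes {1..n}" "transpos c d permutes {1..n}"
    using assms by (auto intro: permutes_swap_id)
  then show ?thesis
    using lifts_commute_conj[OF assms(1) g(1)] conj_transpos[OF g(1)] g(2) by simp
qed

end

section \<open>The hypothetical case of commuting lifts of disjoint transpositions\<close>

locale split_sym_stem_extension = sym_stem_extension +
  assumes n_ge: "4 \<le> n" and split: "lifts_commute (transpos 1 2) (transpos 3 4)"
begin

lemma transpos_12: "transpos 1 2 permutes {1..n}"
  using n_ge by (intro permutes_swap_id) auto

text \<open>The centralizer of (1 2) is <(1 2)> x Sym{3..n}. The second factor is generated by
  transpositions disjoint from (1 2), to which the assumption \<open>split\<close> carries over by
  conjugation.\<close>

lemma lifts_commute_centralizer:
  assumes p: "p permutes {1..n}" and comm: "p \<circ> transpos 1 2 = transpos 1 2 \<circ> p"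
  shows "lifts_commute p (transpos 1 2)"
proof -
  have supp: "lifts_commute q (transpos 1 2)" if "q permutes {3..n}" for q
    using that finite_atLeastAtMost
  proof (induction rule: permutes_induct)
    case id
    then show ?case using lifts_commute_id transpos_12 by blast
  next
    case (swap a b q)
    have "lifts_commute (transpos 1 2) (transpos a b)"
      by (rule lifts_commute_transpos[OF split]) (use n_ge swap in auto)
    moreover have "transpos a b permutes {1..n}" "q permutes {1..n}"
      using swap permutes_subset[of q "{3..n}" "{1..n}"] by (auto intro!: permutes_swap_id)
    ultimately show ?case
      using lifts_commute_comp swap.IH lifts_commute_sym transpos_12 by blast
  qed
  have app: "p (transpos 1 2 i) = transpos 1 2 (p i)" for i
    using comm by (metis comp_apply)
  have fixes12: "lifts_commute q (transpos 1 2)"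
    if q: "q permutes {1..n}" "q 1 = 1" "q 2 = 2" for q
  proof -
    have "q permutes {3..n}"
    proof (rule permutes_superset[OF q(1)])
      fix i assume "i \<in> {1..n} - {3..n}"
      then have "i = 1 \<or> i = 2" by auto
      then show "q i = i" using q by blast
    qed
    then show ?thesis by (rule supp)
  qed
  have "p 1 \<in> {1, 2}"
  proof (rule ccontr)
    assume "p 1 \<notin> {1, 2}"
    then have "p 2 = p 1" using app[of 1] by simp
    then show False using permutes_inj[OF p] by (simp add: inj_eq)
  qed
  then consider "p 1 = 1" | "p 1 = 2" by blast
  then show ?thesis
  proof cases
    case 1
    then show ?thesis using fixes12[OF p] app[of 1] by simp
  next
    case 2
    \<comment> \<open>Multiplying by (1 2) removes the exchange of 1 and 2 and leads back to the
      permutations of {3..n}.\<close>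
    let ?q = "transpos 1 2 \<circ> p"
    have q: "?q permutes {1..n}" using p transpos_12 permutes_compose by blast
    have "lifts_commute ?q (transpos 1 2)"
      using fixes12[OF q] 2 app[of 1] by simp
    then have "lifts_commute (transpos 1 2 \<circ> ?q) (transpos 1 2)"
      using lifts_commute_comp lifts_commute_refl transpos_12 q by blast
    then show ?thesis by (simp flip: comp_assoc)
  qed
qed

definition base :: 'a where
  "base = (SOME t. t \<in> carrier H \<and> \<pi> t = transpos 1 2)"

lemma base: "base \<in> carrier H" "\<pi> base = transpos 1 2"
  using someI_ex[of "\<lambda>t. t \<in> carrier H \<and> \<pi> t = transpos 1 2"] proj_surj[OF transpos_12]
  unfolding base_def by blast+

definition base_class :: "'a set" where
  "base_class = {h \<otimes> base \<otimes> inv h | h. h \<in> carrier H}"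

lemma base_class_closed: "y \<in> base_class \<Longrightarrow> y \<in> carrier H"
  using base by (auto simp: base_class_def)

text \<open>If conjugates of t by h and h' have the same image, then the image of k = h'^-1 h
  centralizes (1 2). By the preceding centralizer lemma k commutes with t itself, so the conjugates
  coincide.\<close>

lemma base_class_proj_inj:
  assumes "y \<in> base_class" "y' \<in> base_class" "\<pi> y = \<pi> y'"
  shows "y = y'"
proof -
  obtain h h' where h: "h \<in> carrier H" "y = h \<otimes> base \<otimes> inv h" "h' \<in> carrier H" "y' = h' \<otimes> base \<otimes> inv h'"
    using assms unfolding base_class_def by blast
  define k where "k = inv h' \<otimes> h"
  have k: "k \<in> carrier H" "h = h' \<otimes> k" using h by (simp_all add: k_def flip: m_assoc)
  note b = base(1)
  have y: "y = h' \<otimes> (k \<otimes> base \<otimes> inv k) \<otimes> inv h'"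
    unfolding h(2) k(2) using k(1) h(3) b by (simp add: inv_mult_group m_assoc)
  have "\<pi> (inv h' \<otimes> y \<otimes> h') = \<pi> (inv h' \<otimes> y' \<otimes> h')"
    using assms h b by (simp add: proj_mult)
  moreover have "inv h' \<otimes> y \<otimes> h' = k \<otimes> base \<otimes> inv k"
    unfolding y using k(1) h(3) b by (simp add: m_assoc inv_cancel_left)
  moreover have "inv h' \<otimes> y' \<otimes> h' = base"
    unfolding h(4) using h(3) b by (simp add: m_assoc inv_cancel_left)
  ultimately have "\<pi> (k \<otimes> base \<otimes> inv k \<otimes> k) = \<pi> (base \<otimes> k)"
    using k(1) b by (simp add: proj_mult)
  then have "\<pi> k \<circ> transpos 1 2 = transpos 1 2 \<circ> \<pi> k"
    using k(1) b base(2) by (simp add: m_assoc proj_mult)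
  then have "k \<otimes> base = base \<otimes> k"
    using lifts_commute_centralizer[of "\<pi> k"] proj_permutes[OF k(1)] lifts_commuteD[OF _ k(1) b] base(2)
    by simp
  then have "k \<otimes> base \<otimes> inv k = base" using k(1) b by (simp add: m_assoc)
  then show ?thesis using y h(4) by simp
qed

lemma base_class_conj:
  assumes "y \<in> base_class" "g \<in> carrier H"
  shows "g \<otimes> y \<otimes> inv g \<in> base_class"
proof -
  obtain h where h: "h \<in> carrier H" "y = h \<otimes> base \<otimes> inv h"
    using assms unfolding base_class_def by blast
  then have "g \<otimes> y \<otimes> inv g = (g \<otimes> h) \<otimes> base \<otimes> inv (g \<otimes> h)"
    using assms base by (simp add: inv_mult_group m_assoc)
  then show ?thesis using assms h unfolding base_class_def by blast
qed

lemma base_square: "\<pi> (base \<otimes> base) = id" "base \<otimes> base \<in> carrier H"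
  using base by (simp_all add: proj_mult)

text \<open>The square of t lies in the kernel, hence is central and unchanged by
  conjugation.\<close>

lemma base_class_square:
  assumes "y \<in> base_class"
  shows "y \<otimes> y = base \<otimes> base"
proof -
  obtain h where h: "h \<in> carrier H" "y = h \<otimes> base \<otimes> inv h"
    using assms unfolding base_class_def by blast
  have "y \<otimes> y = h \<otimes> (base \<otimes> base) \<otimes> inv h"
    using h base conj_mult by simp
  also have "\<dots> = base \<otimes> base"
    unfolding kernel_commutes[OF base_square(2,1) h(1), symmetric]
    using h(1) base_square(2) by (simp add: m_assoc del: m_closed)
  finally show ?thesis .
qed

definition lift_transpos :: "nat \<Rightarrow> nat \<Rightarrow> 'a" where
  "lift_transpos a b = (SOME y. y \<in> base_class \<and> \<pi> y = transpos a b)"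

lemma lift_transpos:
  assumes "a \<in> {1..n}" "b \<in> {1..n}" "a \<noteq> b"
  shows "lift_transpos a b \<in> base_class" "\<pi> (lift_transpos a b) = transpos a b"
proof -
  obtain g where g: "g permutes {1..n}" "map g [1, 2] = [a, b]"
    using permutes_map_list[of "[1, 2]" "[a, b]" "{1..n}"] assms n_ge by auto
  obtain h where h: "h \<in> carrier H" "\<pi> h = g" using g proj_surj by blast
  have "h \<otimes> base \<otimes> inv h \<in> base_class" using h unfolding base_class_def by blast
  moreover have "\<pi> (h \<otimes> base \<otimes> inv h) = transpos a b"
    using h base g conj_transpos[OF g(1), of 1 2] by (simp add: proj_mult proj_inv)
  ultimately have "\<exists>y. y \<in> base_class \<and> \<pi> y = transpos a b" by blast
  from someI_ex[OF this] show "lift_transpos a b \<in> base_class" "\<pi> (lift_transpos a b) = transpos a b"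
    unfolding lift_transpos_def by blast+
qed

lemma lift_transpos_commute: "lift_transpos a b = lift_transpos b a"
  by (simp add: lift_transpos_def transpose_commute)

text \<open>Both sides of the conjugation relation lie in the class of t and have the same image, so
  injectivity on the class makes the relation exact instead of valid up to the kernel.\<close>

lemma lift_transpos_conj:
  assumes "a \<in> {1..n}" "b \<in> {1..n}" "a \<noteq> b" "c \<in> {1..n}" "d \<in> {1..n}" "c \<noteq> d"
  shows "lift_transpos a b \<otimes> lift_transpos c d =
    lift_transpos (transpos a b c) (transpos a b d) \<otimes> lift_transpos a b"
proof -
  let ?s = "lift_transpos a b" and ?t = "lift_transpos c d"
  have s: "?s \<in> carrier H" and t: "?t \<in> carrier H"
    using lift_transpos assms base_class_closed by blast+
  have perm: "transpos a b permutes {1..n}" using assms by (intro permutes_swap_id)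
  have img: "transpos a b c \<in> {1..n}" "transpos a b d \<in> {1..n}" "transpos a b c \<noteq> transpos a b d"
    using permutes_in_image[OF perm] assms transpose_eq_imp_eq by metis+
  have "?s \<otimes> ?t \<otimes> inv ?s = lift_transpos (transpos a b c) (transpos a b d)"
  proof (rule base_class_proj_inj)
    show "?s \<otimes> ?t \<otimes> inv ?s \<in> base_class"
      using base_class_conj lift_transpos assms s by blast
    show "lift_transpos (transpos a b c) (transpos a b d) \<in> base_class"
      using lift_transpos img by blast
    show "\<pi> (?s \<otimes> ?t \<otimes> inv ?s) = \<pi> (lift_transpos (transpos a b c) (transpos a b d))"
      using s t lift_transpos(2) img assms conj_transpos[OF perm, of c d]
      by (simp add: proj_mult proj_inv)
  qed
  then have "lift_transpos (transpos a b c) (transpos a b d) \<otimes> ?s = ?s \<otimes> ?t \<otimes> inv ?s \<otimes> ?s" by simp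
  also have "\<dots> = ?s \<otimes> ?t" using s t by (simp add: m_assoc)
  finally show ?thesis by simp
qed

text \<open>The integer component counts the factors of a product of lifts: among the powers of the square
  of a lift it singles out the trivial one as the only power of degree 0.\<close>

abbreviation graded :: "('a \<times> int) monoid" where
  "graded \<equiv> H \<times>\<times> integer_group"

abbreviation square_powers :: "('a \<times> int) set" where
  "square_powers \<equiv> {((base \<otimes> base) [^] j, 2 * j) | j::int. True}"

lemma group_graded: "group graded"
  by (simp add: DirProd_group is_group)

lemma subgroup_square_powers: "subgroup square_powers graded"
proof -
  interpret D: group graded by (rule group_graded)
  note c = base_square(2)
  show ?thesis
  proof (rule D.subgroupI)
    show "square_powers \<subseteq> carrier graded" using c by auto
    show "square_powers \<noteq> {}" by blast
    fix x assume "x \<in> square_powers"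
    then obtain j :: int where j: "x = ((base \<otimes> base) [^] j, 2 * j)" by blast
    have "inv\<^bsub>graded\<^esub> x = ((base \<otimes> base) [^] (- j), 2 * (- j))"
      unfolding j using c by (simp add: inv_DirProd[OF is_group] int_pow_neg)
    then show "inv\<^bsub>graded\<^esub> x \<in> square_powers" by blast
    fix y assume "y \<in> square_powers"
    then obtain k :: int where k: "y = ((base \<otimes> base) [^] k, 2 * k)" by blast
    have "x \<otimes>\<^bsub>graded\<^esub> y = ((base \<otimes> base) [^] (j + k), 2 * (j + k))"
      unfolding j k using c by (simp add: int_pow_mult)
    then show "x \<otimes>\<^bsub>graded\<^esub> y \<in> square_powers" by blast
  qed
qed

lemma proj_int_pow_square: "\<pi> ((base \<otimes> base) [^] (j::int)) = id"
proof -
  interpret S: group "sym_group n" by (rule sym_group_is_group)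
  show ?thesis
    using group_hom.hom_int_pow[OF proj_group_hom base_square(2), of j] base_square(1) S.int_pow_one[of j]
    by (simp add: sym_group_one)
qed

lemma transposition_lifts_graded:
  "transposition_lifts graded (\<pi> \<circ> fst) square_powers n (\<lambda>a b. (lift_transpos a b, 1))"
proof (intro transposition_lifts.intro transposition_lifts_axioms.intro group_graded subgroup_square_powers)
  fix x y assume "x \<in> carrier graded" "y \<in> carrier graded"
  then show "(\<pi> \<circ> fst) (x \<otimes>\<^bsub>graded\<^esub> y) = (\<pi> \<circ> fst) x \<circ> (\<pi> \<circ> fst) y"
    by (cases x; cases y) (simp add: proj_mult)
next
  fix z assume "z \<in> square_powers"
  then show "(\<pi> \<circ> fst) z = id" using proj_int_pow_square by auto
next
  fix a b assume ab: "a \<in> {1..n}" "b \<in> {1..n}" "a \<noteq> b"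
  note s = lift_transpos[OF ab] base_class_closed[OF lift_transpos(1)[OF ab]]
  show "(lift_transpos a b, 1) \<in> carrier graded" using s by simp
  show "(\<pi> \<circ> fst) (lift_transpos a b, 1::int) = transpos a b" using s by simp
  show "\<exists>z\<in>square_powers. (lift_transpos b a, 1) = z \<otimes>\<^bsub>graded\<^esub> (lift_transpos a b, 1)"
    using s lift_transpos_commute[of a b]
    by (intro bexI[of _ "((base \<otimes> base) [^] (0::int), 2 * 0)"]) auto
  \<comment> \<open>Only the square takes a nontrivial exponent, j = 1 with degree 2; swap and
    conjugation hold with j = 0.\<close>
  have "(lift_transpos a b, 1) \<otimes>\<^bsub>graded\<^esub> (lift_transpos a b, 1)
      = ((base \<otimes> base) [^] (1::int), 2 * 1)"
    using base_class_square[OF s(1)] base by simp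
  then show "(lift_transpos a b, 1) \<otimes>\<^bsub>graded\<^esub> (lift_transpos a b, 1) \<in> square_powers"
    by blast
  show "z \<otimes>\<^bsub>graded\<^esub> (lift_transpos a b, 1) = (lift_transpos a b, 1) \<otimes>\<^bsub>graded\<^esub> z"
    if "z \<in> square_powers" for z
    using that s kernel_commutes[OF int_pow_closed[OF base_square(2)] proj_int_pow_square s(3)] by auto
  fix c d assume cd: "c \<in> {1..n}" "d \<in> {1..n}" "c \<noteq> d"
  have perm: "transpos a b permutes {1..n}" using ab by (intro permutes_swap_id)
  have img: "transpos a b c \<in> {1..n}" "transpos a b d \<in> {1..n}" "transpos a b c \<noteq> transpos a b d"
    using permutes_in_image[OF perm] cd transpose_eq_imp_eq by metis+
  show "\<exists>z\<in>square_powers. (lift_transpos a b, 1) \<otimes>\<^bsub>graded\<^esub> (lift_transpos c d, 1) =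
      z \<otimes>\<^bsub>graded\<^esub> ((lift_transpos (transpos a b c) (transpos a b d), 1) \<otimes>\<^bsub>graded\<^esub> (lift_transpos a b, 1))"
    using lift_transpos_conj[OF ab cd] s base_class_closed[OF lift_transpos(1)[OF img]]
    by (intro bexI[of _ "((base \<otimes> base) [^] (0::int), 2 * 0)"]) auto
qed

text \<open>Every element of H is a kernel element times a product of the chosen lifts. In a
  commutator the central factors cancel and so do the degrees.\<close>

theorem kernel_trivial:
  assumes x: "x \<in> carrier H" "\<pi> x = id"
  shows "x = \<one>"
proof -
  interpret D: transposition_lifts graded "\<pi> \<circ> fst" square_powers n "\<lambda>a b. (lift_transpos a b, 1)"
    by (rule transposition_lifts_graded)
  let ?P = "generate graded D.lifts"
  have P: "subgroup ?P graded"
    by (rule D.generate_is_subgroup) (use D.T_closed in blast)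
  \<comment> \<open>The products of lifts of total degree 0. This subgroup contains all commutators,
    hence the derived subgroup, hence the kernel.\<close>
  define Q where "Q = {y \<in> carrier H. (y, 0) \<in> ?P}"
  have Q: "subgroup Q H"
  proof (rule subgroupI)
    show "Q \<subseteq> carrier H" by (auto simp: Q_def)
    show "Q \<noteq> {}" using subgroup.one_closed[OF P] by (auto simp: Q_def)
    show "inv y \<in> Q" if "y \<in> Q" for y
      using that subgroup.m_inv_closed[OF P, of "(y, 0)"]
      by (auto simp: Q_def inv_DirProd[OF is_group])
    show "y \<otimes> y' \<in> Q" if "y \<in> Q" "y' \<in> Q" for y y'
      using that subgroup.m_closed[OF P, of "(y, 0)" "(y', 0)"] by (auto simp: Q_def)
  qed
  have comm: "h \<otimes> k \<otimes> inv h \<otimes> inv k \<in> Q" if hk: "h \<in> carrier H" "k \<in> carrier H" for h k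
  proof -
    have ex: "\<exists>z y i. z \<in> carrier H \<and> \<pi> z = id \<and> y \<in> carrier H \<and> u = z \<otimes> y \<and> (y, i) \<in> ?P"
      if u: "u \<in> carrier H" for u
    proof -
      obtain g where g: "g \<in> ?P" "(\<pi> \<circ> fst) g = \<pi> u"
        using D.generate_lifts_surj[OF proj_permutes[OF u]] by blast
      have "fst g \<in> carrier H" using subgroup.mem_carrier[OF P g(1)] by auto
      then obtain z where z: "z \<in> carrier H" "\<pi> z = id" "u = z \<otimes> fst g"
        using same_proj[of "fst g" u] g(2) u by auto
      have "(fst g, snd g) \<in> ?P" using g(1) by simp
      then show ?thesis using z \<open>fst g \<in> carrier H\<close> by blast
    qed
    obtain z y i where z: "z \<in> carrier H" "\<pi> z = id" "y \<in> carrier H" "h = z \<otimes> y" "(y, i) \<in> ?P"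
      using ex[OF hk(1)] by blast
    obtain z' y' i' where z': "z' \<in> carrier H" "\<pi> z' = id" "y' \<in> carrier H" "k = z' \<otimes> y'" "(y', i') \<in> ?P"
      using ex[OF hk(2)] by blast
    have kc: "z \<otimes> v = v \<otimes> z" "z' \<otimes> v = v \<otimes> z'" if "v \<in> carrier H" for v
      using kernel_commutes z z' that by auto
    define c where "c = y \<otimes> y' \<otimes> inv y \<otimes> inv y'"
    have c: "c \<in> carrier H" "y \<otimes> y' = c \<otimes> (y' \<otimes> y)"
      using z z' by (simp_all add: c_def m_assoc inv_cancel_left)
    have "h \<otimes> k = (z \<otimes> z') \<otimes> (c \<otimes> (y' \<otimes> y))"
      using z z' kc(2)[of y] c mult_mult_swap[of z y z' y'] by simp
    also have "\<dots> = c \<otimes> ((z \<otimes> z') \<otimes> (y' \<otimes> y))"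
      using z z' kernel_commutes[of "z \<otimes> z'" c] c by (simp add: proj_mult flip: m_assoc)
    also have "(z \<otimes> z') \<otimes> (y' \<otimes> y) = k \<otimes> h"
      using z z' kc(1)[of y'] kc(1)[of z'] mult_mult_swap[of z' y' z y] by simp
    finally have eq: "h \<otimes> k \<otimes> inv h \<otimes> inv k = c"
      using eq_commutatorI[OF c(1) hk] by simp
    have "(c, 0) \<in> ?P"
    proof -
      have "(y, i) \<otimes>\<^bsub>graded\<^esub> (y', i') \<otimes>\<^bsub>graded\<^esub> inv\<^bsub>graded\<^esub> (y, i) \<otimes>\<^bsub>graded\<^esub> inv\<^bsub>graded\<^esub> (y', i') \<in> ?P"
        using z z' P by (meson subgroup.m_closed subgroup.m_inv_closed)
      then show ?thesis unfolding c_def using z z' by (simp add: inv_DirProd[OF is_group])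
    qed
    then show ?thesis unfolding eq Q_def using c(1) by blast
  qed
  have "derived H (carrier H) \<subseteq> Q"
    unfolding derived_def by (rule generate_subgroup_incl[OF _ Q]) (use comm in blast)
  then have "(x, 0) \<in> ?P" using kernel_derived[OF x] by (auto simp: Q_def)
  then have "(x, 0) \<in> square_powers"
    by (rule D.generate_lifts_proj_id) (use x in simp)
  then show ?thesis by auto
qed

end

section \<open>Schur covers\<close>

text \<open>The definition of a Schur cover compares only with groups on natural numbers, whereas
  the Clifford extension consists of functions. Transport along an injection makes it
  eligible.\<close>

lemma stem_extension_nat_copy:
  fixes H :: "('b, 'c) monoid_scheme"
  assumes stem: "stem_extension G H \<pi>" and fin: "finite (carrier H)"
  obtains H' :: "nat monoid" and \<pi>' where "stem_extension G H' \<pi>'" "finite (carrier H')"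
    "card (kernel H' G \<pi>') = card (kernel H G \<pi>)"
proof -
  obtain f :: "'b \<Rightarrow> nat" where f: "inj_on f (carrier H)"
    using finite_imp_inj_to_nat_seg[OF fin] by blast
  define g where "g = inv_into (carrier H) f"
  have gf: "g (f x) = x" if "x \<in> carrier H" for x
    using f that by (simp add: g_def)
  interpret H: group H using stem by (simp add: stem_extension_def)
  define H' where "H' = image_group f H"
  have carr: "carrier H' = f ` carrier H" by (simp add: H'_def image_group_carrier)
  have iso: "f \<in> iso H H'" using f by (auto simp: iso_def hom_def bij_betw_def H'_def image_group_def)
  have grp: "group H'"
    using H.iso_imp_img_group[OF iso] by (simp add: H'_def image_group_def)
  interpret f: group_hom H H' f
    using iso grp by (simp add: group_hom_def group_hom_axioms_def iso_def)
  interpret f': group_hom H' H g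
    using H.iso_set_sym[OF iso] grp unfolding g_def
    by (simp add: group_hom_def group_hom_axioms_def iso_def)
  have epi: "\<pi> \<circ> g \<in> epi H' G"
  proof -
    have "g ` carrier H' = carrier H" using gf by (force simp: carr)
    moreover have "\<pi> \<in> epi H G" using stem by (simp add: stem_extension_def)
    ultimately have "(\<pi> \<circ> g) ` carrier H' = carrier G" "\<pi> \<circ> g \<in> hom H' G"
      using hom_compose[OF f'.homh, of \<pi> G] unfolding epi_def image_comp[symmetric] by auto
    then show ?thesis by (simp add: epi_def)
  qed
  have ker: "kernel H' G (\<pi> \<circ> g) = f ` kernel H G \<pi>"
    using gf by (force simp: kernel_def carr)
  have "f ` kernel H G \<pi> \<subseteq> grp_center H'"
  proof -
    have "f z \<in> grp_center H'" if "z \<in> grp_center H" for z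
      using that unfolding grp_center_def carr by (auto simp flip: f.hom_mult)
    then show ?thesis using stem unfolding stem_extension_def by blast
  qed
  moreover have "f ` kernel H G \<pi> \<subseteq> derived H' (carrier H')"
  proof -
    have "derived H' (carrier H') = f ` derived H (carrier H)"
      using f.derived_img[OF order_refl] carr by simp
    then show ?thesis using stem unfolding stem_extension_def by blast
  qed
  ultimately have "stem_extension G H' (\<pi> \<circ> g)"
    unfolding stem_extension_def ker using stem grp epi by (simp add: stem_extension_def)
  moreover have "finite (carrier H')" using fin carr by simp
  moreover have "card (kernel H' G (\<pi> \<circ> g)) = card (kernel H G \<pi>)"
    unfolding ker by (rule card_image) (use f in \<open>auto intro: inj_on_subset simp: kernel_def\<close>)
  ultimately show ?thesis using that by blast
qed

locale sym_schur_cover =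
  fixes H :: "('b, 'c) monoid_scheme" (structure) and n :: nat and \<pi> :: "'b \<Rightarrow> nat \<Rightarrow> nat"
  assumes cover: "schur_cover (sym_group n) H \<pi>" and n_ge: "4 \<le> n"

sublocale sym_schur_cover \<subseteq> sym_stem_extension
proof (intro sym_stem_extension.intro sym_stem_extension_axioms.intro)
  show "stem_extension (sym_group n) H \<pi>" using cover by (simp add: schur_cover_def)
  then show "group H" by (simp add: stem_extension_def)
qed

context sym_schur_cover
begin

text \<open>The one place where maximality is applied: the kernel is at least as large as that of
  \<open>spin_cover\<close>.\<close>

lemma kernel_nontrivial: "\<exists>z \<in> carrier H. \<pi> z = id \<and> z \<noteq> \<one>"
proof -
  obtain H' :: "nat monoid" and \<pi>' where H': "stem_extension (sym_group n) H' \<pi>'" "finite (carrier H')"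
    "card (kernel H' (sym_group n) \<pi>') = card (kernel (spin_cover n) (sym_group n) snd)"
    using stem_extension_nat_copy[OF spin_cover_stem_extension(1,2)[OF n_ge]] by metis
  then have "card (kernel H' (sym_group n) \<pi>') \<le> card (kernel H (sym_group n) \<pi>)"
    using cover unfolding schur_cover_def by blast
  then have "2 \<le> card (kernel H (sym_group n) \<pi>)"
    using H'(3) spin_cover_stem_extension(3)[OF n_ge] by linarith
  then have "\<not> kernel H (sym_group n) \<pi> \<subseteq> {\<one>}"
    using card_mono[of "{\<one>}" "kernel H (sym_group n) \<pi>"] by fastforce
  then show ?thesis by (auto simp: kernel_def sym_group_one)
qed

theorem not_lifts_commute_disjoint_transpos:
  assumes "distinct [a, b, c, d]" "{a, b, c, d} \<subseteq> {1..n}"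
  shows "\<not> lifts_commute (transpos a b) (transpos c d)"
proof
  assume "lifts_commute (transpos a b) (transpos c d)"
  then have "lifts_commute (transpos 1 2) (transpos 3 4)"
    by (rule lifts_commute_transpos) (use assms n_ge in auto)
  then interpret split_sym_stem_extension H n \<pi>
    by unfold_locales (use n_ge in auto)
  show False using kernel_trivial kernel_nontrivial by blast
qed

end

section \<open>Cyclicity of two-generated abelian groups\<close>

lemma (in group) cyclic_pair_iff:
  assumes xy: "x \<in> carrier G" "y \<in> carrier G"
  shows "cyclic_group (subgroup_generated G {x, y}) \<longleftrightarrow>
    (\<exists>g \<in> generate G {x, y}. x \<in> generate G {g} \<and> y \<in> generate G {g})"
proof -
  let ?K = "subgroup_generated G {x, y}"
  interpret K: group ?K by simp
  have carr: "carrier ?K = generate G {x, y}"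
    using xy by (simp add: carrier_subgroup_generated)
  have sub: "subgroup (generate G {x, y}) G"
    using xy by (intro generate_is_subgroup) auto
  have mem: "x \<in> carrier ?K" "y \<in> carrier ?K"
    unfolding carr by (auto intro: generate.incl)
  have pow: "range (\<lambda>k::int. g [^]\<^bsub>?K\<^esub> k) = generate G {g}" if "g \<in> carrier ?K" for g
    using that generate_pow[of g] subgroup.mem_carrier[OF sub, of g]
    by (auto simp: int_pow_subgroup_generated carr)
  have "carrier ?K = generate G {g} \<longleftrightarrow> x \<in> generate G {g} \<and> y \<in> generate G {g}"
    if g: "g \<in> carrier ?K" for g
  proof
    assume "x \<in> generate G {g} \<and> y \<in> generate G {g}"
    moreover have "subgroup (generate G {g}) G"
      using g subgroup.mem_carrier[OF sub, of g] by (intro generate_is_subgroup) (auto simp: carr)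
    ultimately have "carrier ?K \<subseteq> generate G {g}"
      unfolding carr by (intro generate_subgroup_incl) auto
    moreover have "generate G {g} \<subseteq> carrier ?K"
      using g sub unfolding carr by (intro generate_subgroup_incl) auto
    ultimately show "carrier ?K = generate G {g}" by blast
  qed (use mem in blast)
  then show ?thesis
    unfolding K.cyclic_group using pow by (metis carr)
qed

lemma (in group) comm_group_generated_pair:
  assumes "x \<in> carrier G" "y \<in> carrier G" "x \<otimes> y = y \<otimes> x"
  shows "comm_group (subgroup_generated G {x, y})"
proof -
  let ?K = "subgroup_generated G {x, y}"
  interpret K: group ?K by simp
  have carr: "carrier ?K = generate G {x, y}"
    using assms by (simp add: carrier_subgroup_generated)
  have S: "{x, y} \<subseteq> carrier G" using assms by simp
  have one: "s \<otimes> u = u \<otimes> s" if "s \<in> {x, y}" "u \<in> generate G {x, y}" for s u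
    by (rule generate_commutes[OF _ S _ that(2)]) (use assms that in auto)
  have "u \<otimes> v = v \<otimes> u" if "u \<in> generate G {x, y}" "v \<in> generate G {x, y}" for u v
    by (rule generate_commutes[OF _ S _ that(2)]) (use that one generate_in_carrier[OF S] in \<open>auto simp: eq_commute\<close>)
  then show ?thesis
    by (intro K.group_comm_groupI) (simp add: carr)
qed

text \<open>Otherwise <u> and <v> are subgroups of order r with trivial intersection, and their
  product is a subgroup of order r^2, against Lagrange.\<close>

lemma (in comm_group) prime_pair_cyclic:
  fixes r :: nat
  assumes r: "Factorial_Ring.prime r" "\<not> r ^ 2 dvd order G"
    and u: "u \<in> carrier G" "u [^] r = \<one>" and v: "v \<in> carrier G" "v [^] r = \<one>"
  shows "u \<in> generate G {v} \<or> v \<in> generate G {u}"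
proof (rule ccontr)
  assume neg: "\<not> ?thesis"
  let ?U = "generate G {u}" and ?V = "generate G {v}"
  have one: "\<one> \<in> ?U" "\<one> \<in> ?V" by (auto intro: generate.one)
  have ord_r: "ord w = r" if "w \<in> carrier G" "w [^] r = \<one>" "w \<noteq> \<one>" for w
  proof -
    have "ord w dvd r" using that pow_eq_id by blast
    moreover have "ord w \<noteq> 1" using that ord_eq_1 by blast
    ultimately show ?thesis using r(1) prime_nat_iff by blast
  qed
  have card_r: "card (generate G {w}) = r" if "w \<in> carrier G" "w [^] r = \<one>" "w \<noteq> \<one>" for w
    using ord_r[OF that] generate_pow_card[OF that(1)] by simp
  have U: "subgroup ?U G" and V: "subgroup ?V G"
    using u v by (auto intro: generate_is_subgroup)
  have ne: "u \<noteq> \<one>" "v \<noteq> \<one>" using neg one by metis+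
  have pow_r: "w [^] r = \<one>" if w: "w \<in> ?U" for w
  proof -
    obtain k :: int where "w = u [^] k" using w generate_pow[OF u(1)] by auto
    then have "w [^] r = (u [^] r) [^] k" using u(1) by (metis int_pow_int int_pow_pow mult.commute)
    then show ?thesis using u by simp
  qed
  have inter: "?U \<inter> ?V = {\<one>}"
  proof (rule ccontr)
    assume "?U \<inter> ?V \<noteq> {\<one>}"
    then obtain w where w: "w \<in> ?U" "w \<in> ?V" "w \<noteq> \<one>" using one by blast
    have wc: "w \<in> carrier G" using subgroup.mem_carrier[OF U w(1)] .
    have "generate G {w} \<subseteq> ?U" using w U by (intro generate_subgroup_incl) auto
    moreover have "card (generate G {w}) = card ?U"
      using card_r[OF wc pow_r[OF w(1)] w(3)] card_r[OF u ne(1)] by simp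
    moreover have "finite ?U" using card_r[OF u ne(1)] r(1) by (metis card.infinite not_prime_0)
    ultimately have "generate G {w} = ?U" using card_subset_eq by metis
    then have "u \<in> generate G {w}" using generate.incl[of u "{u}"] by simp
    moreover have "generate G {w} \<subseteq> ?V" using w V by (intro generate_subgroup_incl) auto
    ultimately show False using neg by blast
  qed
  interpret D: group_disjoint_sum G ?U ?V
    using U V by (simp add: group_disjoint_sum_def is_group)
  let ?A = "subgroup_generated G ?U \<times>\<times> subgroup_generated G ?V" and ?f = "\<lambda>(x, y). x \<otimes> y"
  have mon: "?f \<in> mon ?A G"
    using D.mon_group_mul_eq inter m_comm D.AG.mem_carrier D.BG.mem_carrier by blast
  have carrA: "carrier ?A = ?U \<times> ?V"
    by (simp add: D.AG.carrier_subgroup_generated_subgroup D.BG.carrier_subgroup_generated_subgroup)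
  have "group ?A" by (simp add: DirProd_group)
  then have "group_hom ?A G ?f"
    using mon by (simp add: group_hom_def group_hom_axioms_def mon_def is_group)
  then have "subgroup (?f ` carrier ?A) G"
    by (rule group_hom.img_is_subgroup)
  then have "card (?f ` carrier ?A) dvd order G"
    using lagrange by (metis dvd_triv_right)
  moreover have "card (?f ` carrier ?A) = r ^ 2"
    using card_image[of ?f "carrier ?A"] mon card_r[OF u ne(1)] card_r[OF v ne(2)]
    unfolding carrA by (simp add: mon_def card_cartesian_product power2_eq_square carrA)
  ultimately show False using r(2) by simp
qed

text \<open>Induction on the exponent: the squares are comparable, say s^2 = t^(2m). Then s t^(-m)
  squares to 1, so it is trivial or the only involution, which is a power of t unless t = 1.\<close>

lemma (in comm_group) two_part_cyclic:
  assumes involution: "\<And>p q. \<lbrakk>p \<in> carrier G; q \<in> carrier G; p \<otimes> p = \<one>; q \<otimes> q = \<one>; p \<noteq> \<one>; q \<noteq> \<one>\<rbrakk> \<Longrightarrow> p = q"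
  shows "\<lbrakk>u \<in> carrier G; v \<in> carrier G; u [^] (2 ^ a :: nat) = \<one>; v [^] (2 ^ a :: nat) = \<one>\<rbrakk> \<Longrightarrow>
    u \<in> generate G {v} \<or> v \<in> generate G {u}"
proof (induction a arbitrary: u v)
  case 0
  then show ?case by (auto intro: generate.one)
next
  case (Suc a)
  have step: "s \<in> generate G {t} \<or> t \<in> generate G {s}"
    if s: "s \<in> carrier G" and t: "t \<in> carrier G" "t [^] (2 ^ Suc a :: nat) = \<one>"
      and st: "s \<otimes> s \<in> generate G {t \<otimes> t}" for s t
  proof -
    obtain m :: int where "s \<otimes> s = (t \<otimes> t) [^] m" using st t generate_pow[of "t \<otimes> t"] by auto
    then have m: "s \<otimes> s = t [^] m \<otimes> t [^] m" using t by (simp add: int_pow_distrib)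
    let ?p = "s \<otimes> inv (t [^] m)"
    have pc: "?p \<in> carrier G" "t [^] m \<in> carrier G" using s t by auto
    have "?p \<otimes> ?p = (s \<otimes> s) \<otimes> (inv (t [^] m) \<otimes> inv (t [^] m))"
      using s pc by (simp add: m_ac)
    also have "\<dots> = \<one>" unfolding m using pc by (simp add: inv_mult[symmetric])
    finally have p: "?p \<otimes> ?p = \<one>" .
    have gen: "subgroup (generate G {t}) G" using t by (auto intro: generate_is_subgroup)
    have tm: "t [^] m \<in> generate G {t}" using t generate_pow[of t] by auto
    have s_eq: "s = ?p \<otimes> t [^] m" using s pc by (simp add: m_assoc)
    show ?thesis
    proof (cases "t = \<one> \<or> ?p = \<one>")
      case True
      then show ?thesis
      proof
        assume "t = \<one>"
        then show ?thesis by (simp add: generate.one)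
      next
        assume "?p = \<one>"
        then have "s = t [^] m" using s_eq pc by simp
        then show ?thesis using tm by simp
      qed
    next
      case False
      \<comment> \<open>2^k is the order of t, so halving this exponent yields an involution in
        <t>.\<close>
      define k where "k = (LEAST k. t [^] (2 ^ k :: nat) = \<one>)"
      have k: "t [^] (2 ^ k :: nat) = \<one>" unfolding k_def using t(2) by (rule LeastI)
      have "k \<noteq> 0" using k False t by (metis nat_pow_eone power_0)
      then obtain l where l: "k = Suc l" using not0_implies_Suc by blast
      let ?q = "t [^] (2 ^ l :: nat)"
      have "?q \<noteq> \<one>" using not_less_Least[of l "\<lambda>k. t [^] (2 ^ k :: nat) = \<one>"] l k_def by auto
      moreover have "?q \<otimes> ?q = \<one>"
        using k l t(1) by (simp add: nat_pow_mult mult_2)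
      moreover have "?q \<in> carrier G" using t by simp
      ultimately have "?p = ?q" using involution pc p False by blast
      moreover have "?q \<in> generate G {t}"
        using generate_pow[OF t(1)] int_pow_int[of G t "2 ^ l"] by (metis (mono_tags, lifting) UNIV_I mem_Collect_eq)
      ultimately have "s \<in> generate G {t}"
        using s_eq subgroup.m_closed[OF gen] tm by metis
      then show ?thesis by blast
    qed
  qed
  have sq: "(w \<otimes> w) [^] (2 ^ a :: nat) = w [^] (2 ^ Suc a :: nat)" if "w \<in> carrier G" for w
    using that by (simp add: nat_pow_distrib nat_pow_mult mult_2)
  have "u \<otimes> u \<in> generate G {v \<otimes> v} \<or> v \<otimes> v \<in> generate G {u \<otimes> u}"
    using Suc.IH[of "u \<otimes> u" "v \<otimes> v"] Suc.prems sq by simp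
  then show ?case using step Suc.prems by blast
qed

text \<open>The bound 120 serves 4! and 5! alike. The 3-part and 5-part are handled by
  \<open>prime_pair_cyclic\<close>, since 9 and 25 do not divide 120; only the 2-part needs the
  assumption on involutions.\<close>

lemma (in comm_group) pair_cyclic_of_order_dvd_120:
  assumes dvd_120: "order G dvd 120"
    and involution: "\<And>p q. \<lbrakk>p \<in> carrier G; q \<in> carrier G; p \<otimes> p = \<one>; q \<otimes> q = \<one>; p \<noteq> \<one>; q \<noteq> \<one>\<rbrakk> \<Longrightarrow> p = q"
    and x: "x \<in> carrier G" and y: "y \<in> carrier G"
  shows "\<exists>g \<in> carrier G. x \<in> generate G {g} \<and> y \<in> generate G {g}"
proof -
  have pow120: "w [^] (120 * k :: nat) = \<one>" if "w \<in> carrier G" for w k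
  proof -
    obtain j where j: "120 = order G * j" using dvd_120 by blast
    have "w [^] (order G * (j * k)) = \<one>"
      using pow_order_eq_1[OF that] that by (simp flip: nat_pow_pow)
    then show ?thesis by (simp add: j mult.assoc)
  qed
  have sub: "subgroup (generate G {w}) G" if "w \<in> carrier G" for w
    using that by (auto intro: generate_is_subgroup)
  have self: "w \<in> generate G {w}" for w by (simp add: generate.incl)
  have common: "\<exists>g \<in> carrier G. g [^] r = \<one> \<and> u \<in> generate G {g} \<and> v \<in> generate G {g}"
    if "u \<in> carrier G" "v \<in> carrier G" "u [^] r = \<one>" "v [^] r = \<one>"
      "u \<in> generate G {v} \<or> v \<in> generate G {u}" for u v and r :: nat
    using that self by blast
  \<comment> \<open>105, 40 and 96 are the idempotents modulo 120 for the factors 8, 3 and 5; their sum is 241.\<close>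
  have parts: "(w [^] (105::nat)) [^] (8::nat) = \<one>" "(w [^] (40::nat)) [^] (3::nat) = \<one>"
    "(w [^] (96::nat)) [^] (5::nat) = \<one>" if "w \<in> carrier G" for w
    using pow120[OF that, of 7] pow120[OF that, of 1] pow120[OF that, of 4] that
    by (simp_all add: nat_pow_pow)
  have "x [^] (105::nat) \<in> generate G {y [^] (105::nat)} \<or> y [^] (105::nat) \<in> generate G {x [^] (105::nat)}"
    by (rule two_part_cyclic[OF involution, where a = 3]) (use x y parts(1) in simp_all)
  then obtain g1 where g1: "g1 \<in> carrier G" "g1 [^] (8::nat) = \<one>"
    "x [^] (105::nat) \<in> generate G {g1}" "y [^] (105::nat) \<in> generate G {g1}"
    using common[OF nat_pow_closed[OF x] nat_pow_closed[OF y] parts(1)[OF x] parts(1)[OF y]] by blast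
  have "\<not> 3 ^ 2 dvd order G" "\<not> 5 ^ 2 dvd order G"
    using dvd_trans[OF _ dvd_120, of "3 ^ 2"] dvd_trans[OF _ dvd_120, of "5 ^ 2"] by auto
  then have "x [^] (40::nat) \<in> generate G {y [^] (40::nat)} \<or> y [^] (40::nat) \<in> generate G {x [^] (40::nat)}"
    "x [^] (96::nat) \<in> generate G {y [^] (96::nat)} \<or> y [^] (96::nat) \<in> generate G {x [^] (96::nat)}"
    using prime_pair_cyclic[OF _ _ nat_pow_closed[OF x] parts(2)[OF x] nat_pow_closed[OF y] parts(2)[OF y]]
      prime_pair_cyclic[OF _ _ nat_pow_closed[OF x] parts(3)[OF x] nat_pow_closed[OF y] parts(3)[OF y]]
    by simp_all
  then obtain g2 g3 where g2: "g2 \<in> carrier G" "g2 [^] (3::nat) = \<one>"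
      "x [^] (40::nat) \<in> generate G {g2}" "y [^] (40::nat) \<in> generate G {g2}"
    and g3: "g3 \<in> carrier G" "g3 [^] (5::nat) = \<one>"
      "x [^] (96::nat) \<in> generate G {g3}" "y [^] (96::nat) \<in> generate G {g3}"
    using common[OF nat_pow_closed[OF x] nat_pow_closed[OF y] parts(2)[OF x] parts(2)[OF y]]
      common[OF nat_pow_closed[OF x] nat_pow_closed[OF y] parts(3)[OF x] parts(3)[OF y]] by blast
  define g where "g = g1 \<otimes> g2 \<otimes> g3"
  have g: "g \<in> carrier G" using g1 g2 g3 by (simp add: g_def)
  have reduce: "w [^] (m * k + 1) = w" "w [^] (m * k) = \<one>" if "w \<in> carrier G" "w [^] m = \<one>" for w and m k :: nat
    using that by (simp_all flip: nat_pow_pow add: nat_pow_mult[symmetric])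
  \<comment> \<open>The multipliers come from 105 = 8 * 13 + 1 = 3 * 35 = 5 * 21, then 40 = 8 * 5 =
    3 * 13 + 1 = 5 * 8, and 96 = 8 * 12 = 3 * 32 = 5 * 19 + 1.\<close>
  have "g [^] (105::nat) = g1" "g [^] (40::nat) = g2" "g [^] (96::nat) = g3"
    using g1(1) g2(1) g3(1) reduce(1)[OF g1(1,2), of 13] reduce(2)[OF g2(1,2), of 35] reduce(2)[OF g3(1,2), of 21]
      reduce(2)[OF g1(1,2), of 5] reduce(1)[OF g2(1,2), of 13] reduce(2)[OF g3(1,2), of 8]
      reduce(2)[OF g1(1,2), of 12] reduce(2)[OF g2(1,2), of 32] reduce(1)[OF g3(1,2), of 19]
    by (simp_all add: g_def nat_pow_distrib)
  moreover have pow_gen: "g [^] (k::nat) \<in> generate G {g}" for k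
    using generate_pow[OF g] int_pow_int[of G g k] by (metis (mono_tags, lifting) UNIV_I mem_Collect_eq)
  ultimately have gi: "g1 \<in> generate G {g}" "g2 \<in> generate G {g}" "g3 \<in> generate G {g}"
    by metis+
  have incl: "generate G {w} \<subseteq> generate G {g}" if "w \<in> generate G {g}" for w
    using that sub[OF g] by (intro generate_subgroup_incl) auto
  have "w \<in> generate G {g}"
    if w: "w \<in> carrier G" "w [^] (105::nat) \<in> generate G {g}" "w [^] (40::nat) \<in> generate G {g}"
      "w [^] (96::nat) \<in> generate G {g}" for w
  proof -
    have "w = w [^] (120 * 2 + 1 :: nat)" using reduce(1)[OF w(1), of 120 2] pow120[OF w(1), of 1] by simp
    also have "\<dots> = w [^] (105::nat) \<otimes> w [^] (40::nat) \<otimes> w [^] (96::nat)"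
      using w(1) by (simp add: nat_pow_mult)
    finally show ?thesis using w subgroup.m_closed[OF sub[OF g]] by metis
  qed
  then show ?thesis using g x y g1 g2 g3 gi incl by blast
qed

section \<open>Pairs of commuting involutions\<close>

lemma distinct_length_le_card:
  "\<lbrakk>distinct xs; set xs \<subseteq> {1..n}\<rbrakk> \<Longrightarrow> length xs \<le> n"
  using card_mono[of "{1..n}" "set xs"] by (simp add: distinct_card)

lemma transpos_comm:
  assumes "distinct [a, b, c, d]"
  shows "transpos a b \<circ> transpos c d = transpos c d \<circ> transpos a b"
  using inj_comp_transpos[OF inj_transpose, of a b c d] assms by simp

lemma double_transpos_involution:
  assumes "distinct [a, b, c, d]"
  shows "(transpos a b \<circ> transpos c d) \<circ> (transpos a b \<circ> transpos c d) = id"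
  using transpos_comm[OF assms] by (metis comp_assoc comp_id transpose_comp_involutory)

lemma eq_transposI:
  assumes "f a = b" "f b = a" and "\<And>i. i \<notin> {a, b} \<Longrightarrow> f i = i"
  shows "f = transpos a b"
  using assms by (auto simp: fun_eq_iff Transposition.transpose_def)

lemma eq_double_transposI:
  assumes "distinct [a, b, c, d]" "f a = b" "f b = a" "f c = d" "f d = c"
    and "\<And>i. i \<notin> {a, b, c, d} \<Longrightarrow> f i = i"
  shows "f = transpos a b \<circ> transpos c d"
proof
  fix i
  consider "i = a" | "i = b" | "i = c" | "i = d" | "i \<notin> {a, b, c, d}" by blast
  then show "f i = (transpos a b \<circ> transpos c d) i"
    using assms by cases simp_all
qed

text \<open>The split is whether q preserves a 2-cycle (a b) of p. If it does not, p and q act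
  regularly on four points. If it does, q or p q fixes a and b, and at most three points are left
  for it, so it is a transposition.\<close>

lemma commuting_involutions_cases:
  fixes p q :: "nat \<Rightarrow> nat"
  assumes n: "n \<le> 5" and p: "p permutes {1..n}" and q: "q permutes {1..n}"
    and pp: "\<And>i. p (p i) = i" and qq: "\<And>i. q (q i) = i" and pq: "\<And>i. p (q i) = q (p i)"
    and ne: "p \<noteq> id" "q \<noteq> id" "p \<noteq> q"
  obtains (regular) a b c d where "distinct [a, b, c, d]" "{a, b, c, d} \<subseteq> {1..n}"
      "p = transpos a b \<circ> transpos c d" "q = transpos a c \<circ> transpos b d"
    | (transposition) a b c d where "distinct [a, b, c, d]" "{a, b, c, d} \<subseteq> {1..n}"
      "transpos c d \<in> {q, p \<circ> q}" "p \<in> {transpos a b, transpos a b \<circ> transpos c d}"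
proof -
  have mem: "i \<in> {1..n}" if "f permutes {1..n}" "f i \<noteq> i" for f i
    using that permutes_not_in by metis
  have img: "f i \<in> {1..n}" if "f permutes {1..n}" "i \<in> {1..n}" for f i
    using that permutes_in_image by metis
  have no_six: False if "distinct [a, b, c, d, e, f]" "set [a, b, c, d, e, f] \<subseteq> {1..n}" for a b c d e f
    using distinct_length_le_card[OF that] n by simp
  \<comment> \<open>An involution that preserves four points and moves a fifth also moves the image
    of the fifth, which makes six points. This is where n <= 5 enters.\<close>
  have fixed: "f e = e"
    if f: "f permutes {1..n}" "\<And>i. f (f i) = i" and abcd: "distinct [a, b, c, d]" "{a, b, c, d} \<subseteq> {1..n}"
      and cl: "{f a, f b, f c, f d} \<subseteq> {a, b, c, d}" and e: "e \<notin> {a, b, c, d}" for f a b c d e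
  proof (rule ccontr)
    assume fe: "f e \<noteq> e"
    have "f e \<notin> {a, b, c, d}"
    proof
      assume "f e \<in> {a, b, c, d}"
      then have "f (f e) \<in> {a, b, c, d}" using cl by blast
      then show False using e f(2) by simp
    qed
    then show False using no_six[of a b c d e "f e"] abcd e fe mem[OF f(1) fe] img[OF f(1)] by auto
  qed
  obtain a where a: "p a \<noteq> a" using ne(1) by (auto simp: fun_eq_iff)
  define b where "b = p a"
  have pb: "p a = b" "p b = a" "a \<noteq> b" using a pp by (auto simp: b_def)
  have ab: "a \<in> {1..n}" "b \<in> {1..n}" using mem[OF p a] img[OF p] by (auto simp: b_def)
  show thesis
  proof (cases "q a \<in> {a, b}")
    case False
    define c where "c = q a"
    define d where "d = q b"
    have vals: "q a = c" "q c = a" "q b = d" "q d = b" "p c = d" "p d = c"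
      using qq pq pb pp by (auto simp: c_def d_def)
    have dist: "distinct [a, b, c, d]"
    proof -
      have "c \<noteq> a" "c \<noteq> b" using False by (auto simp: c_def)
      moreover from this have "d \<noteq> a" "d \<noteq> b" "c \<noteq> d" using vals pb by metis+
      ultimately show ?thesis using pb(3) by simp
    qed
    have sub: "{a, b, c, d} \<subseteq> {1..n}" using ab img[OF q ab(1)] img[OF q ab(2)] vals by simp
    have p_fix: "p i = i" if "i \<notin> {a, b, c, d}" for i
      by (rule fixed[OF p pp dist sub _ that]) (simp add: vals pb)
    have q_fix: "q i = i" if "i \<notin> {a, b, c, d}" for i
      by (rule fixed[OF q qq dist sub _ that]) (simp add: vals)
    have "p = transpos a b \<circ> transpos c d"
      by (rule eq_double_transposI[OF dist pb(1,2) vals(5,6) p_fix])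
    moreover have "q = transpos a c \<circ> transpos b d"
    proof (rule eq_double_transposI[OF _ vals(1-4)])
      show "distinct [a, c, b, d]" using dist by auto
      show "q i = i" if "i \<notin> {a, c, b, d}" for i
        using q_fix[of i] that by blast
    qed
    ultimately show ?thesis using regular[OF dist sub] by blast
  next
    case True
    \<comment> \<open>If q exchanges a and b as p does, the product with p fixes both.\<close>
    define r where "r = (if q a = a then q else p \<circ> q)"
    have r: "r permutes {1..n}" using p q permutes_compose by (auto simp: r_def)
    have rr: "r (r i) = i" for i using pp qq pq by (simp add: r_def)
    have pr: "p (r i) = r (p i)" for i using pq by (simp add: r_def)
    have ra: "r a = a" using True pb by (auto simp: r_def)
    have rb: "r b = b" using pr[of a] ra pb by simp
    have "r \<noteq> id"
    proof
      assume "r = id"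
      then have "p (q i) = i" for i using ne(2) by (auto simp: r_def fun_eq_iff split: if_splits)
      then have "q i = p i" for i using pp by metis
      then show False using ne(3) by (simp add: fun_eq_iff)
    qed
    then obtain c where c: "r c \<noteq> c" by (auto simp: fun_eq_iff)
    define d where "d = r c"
    have rc: "r c = d" "r d = c" "c \<noteq> d" using c rr by (auto simp: d_def)
    have dist: "distinct [a, b, c, d]" using pb ra rb rc by auto
    have sub: "{a, b, c, d} \<subseteq> {1..n}" using ab mem[OF r c] img[OF r, of c] rc by auto
    have r_fix: "r i = i" if "i \<notin> {a, b, c, d}" for i
      by (rule fixed[OF r rr dist sub _ that]) (simp add: ra rb rc)
    have r_eq: "r = transpos c d"
    proof (rule eq_transposI[OF rc(1,2)])
      show "r i = i" if "i \<notin> {c, d}" for i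
        using r_fix[of i] ra rb that by blast
    qed
    \<comment> \<open>As p commutes with r, it preserves the pair of points moved by r.\<close>
    have "r (p c) \<noteq> p c" using pr[of c] rc pp by metis
    then have pc: "p c \<in> {c, d}" using r_fix[of "p c"] ra rb by auto
    have pd: "p d \<in> {c, d}" using pc pp rc pr by (metis insert_iff singletonD)
    have p_fix: "p i = i" if "i \<notin> {a, b, c, d}" for i
      by (rule fixed[OF p pp dist sub _ that]) (use pb pc pd in simp)
    have "p \<in> {transpos a b, transpos a b \<circ> transpos c d}"
    proof (cases "p c = c")
      case True
      then have "p d = d" using pd pp by (metis insert_iff singletonD rc(3))
      have "p = transpos a b"
      proof (rule eq_transposI[OF pb(1,2)])
        show "p i = i" if "i \<notin> {a, b}" for i
          using p_fix[of i] that True \<open>p d = d\<close> by blast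
      qed
      then show ?thesis by blast
    next
      case False
      then have "p c = d" "p d = c" using pc pp by auto
      then have "p = transpos a b \<circ> transpos c d"
        by (intro eq_double_transposI[OF dist pb(1,2) _ _ p_fix])
      then show ?thesis by blast
    qed
    then show ?thesis using transposition[OF dist sub] r_eq by (auto simp: r_def split: if_splits)
  qed
qed

section \<open>Lifts of products of disjoint transpositions, and of cyclic groups\<close>

context sym_stem_extension
begin

lemma transpos_permutes: "{a, b} \<subseteq> {1..n} \<Longrightarrow> transpos a b permutes {1..n}"
  by (simp add: permutes_swap_id)

lemma lifts_commute_imp_comm:
  assumes "lifts_commute p q" "p permutes {1..n}" "q permutes {1..n}"
  shows "p \<circ> q = q \<circ> p"
  using assms proj_surj proj_mult lifts_commuteD by metis

lemma conj_lift:
  assumes "g \<in> carrier H" "x \<in> carrier H" "y \<in> carrier H" "\<pi> g \<circ> \<pi> x \<circ> inv' (\<pi> g) = \<pi> y"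
  obtains z where "z \<in> carrier H" "\<pi> z = id" "g \<otimes> x \<otimes> inv g = z \<otimes> y"
proof -
  have "\<pi> y = \<pi> (g \<otimes> x \<otimes> inv g)" using assms by (simp add: proj_mult proj_inv)
  then show thesis using same_proj[of y "g \<otimes> x \<otimes> inv g"] assms that by blast
qed

lemma square_central:
  assumes "x \<in> carrier H" "y \<in> carrier H" "\<pi> x \<circ> \<pi> x = id"
  shows "x \<otimes> (x \<otimes> y) = y \<otimes> (x \<otimes> x)"
  using kernel_commutes[of "x \<otimes> x" y] assms by (simp add: proj_mult m_assoc)

text \<open>A lift h of (a c)(b d) exchanges the lifts s and t of (a b) and (c d) up to kernel elements, whose
  product is 1 because the square of h is central. Hence s t is conjugate to t s by h.\<close>

lemma lifts_commute_regular:
  assumes dist: "distinct [a, b, c, d]" and sub: "{a, b, c, d} \<subseteq> {1..n}"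
    and comm: "lifts_commute (transpos a b \<circ> transpos c d) (transpos a c \<circ> transpos b d)"
  shows "lifts_commute (transpos a b) (transpos c d)"
proof -
  let ?g = "transpos a c \<circ> transpos b d"
  have g: "?g permutes {1..n}" using sub by (intro permutes_compose transpos_permutes) auto
  obtain s t h where s: "s \<in> carrier H" "\<pi> s = transpos a b" and t: "t \<in> carrier H" "\<pi> t = transpos c d"
    and h: "h \<in> carrier H" "\<pi> h = ?g"
    using proj_surj transpos_permutes sub g by (metis insert_subset)
  have "?g \<circ> transpos a b \<circ> inv' ?g = transpos c d" "?g \<circ> transpos c d \<circ> inv' ?g = transpos a b"
    using conj_transpos[OF g] dist by (auto simp: Transposition.transpose_def)
  then obtain z w where z: "z \<in> carrier H" "\<pi> z = id" "h \<otimes> s \<otimes> inv h = z \<otimes> t"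
    and w: "w \<in> carrier H" "\<pi> w = id" "h \<otimes> t \<otimes> inv h = w \<otimes> s"
    using conj_lift[OF h(1) s(1) t(1)] conj_lift[OF h(1) t(1) s(1)] s t h by metis
  have hs: "h \<otimes> s = z \<otimes> t \<otimes> h" "h \<otimes> t = w \<otimes> s \<otimes> h"
    using conj_eqD[OF h(1) s(1) z(3)] conj_eqD[OF h(1) t(1) w(3)] by blast+
  have "?g \<circ> ?g = id" using dist by (intro double_transpos_involution) auto
  then have "s \<otimes> (h \<otimes> h) = h \<otimes> (h \<otimes> s)" using square_central[OF h(1) s(1)] h by simp
  also have "\<dots> = z \<otimes> (h \<otimes> t) \<otimes> h"
    unfolding hs(1) using kernel_commutes[OF z(1,2) h(1)] h t z by (metis m_assoc m_closed)
  also have "\<dots> = z \<otimes> w \<otimes> s \<otimes> (h \<otimes> h)"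
    unfolding hs(2) using z w s h by (simp add: m_assoc)
  finally have zw: "z \<otimes> w = \<one>"
    using s h z w r_cancel_one[of "s \<otimes> (h \<otimes> h)" "z \<otimes> w"] by (simp add: m_assoc)
  have "(h \<otimes> s \<otimes> inv h) \<otimes> (h \<otimes> t \<otimes> inv h) = z \<otimes> w \<otimes> (t \<otimes> s)"
    unfolding z(3) w(3) using mult_mult_swap[of z t w s] kernel_commutes[OF w(1,2) t(1)] z w s t by simp
  then have 1: "h \<otimes> (s \<otimes> t) \<otimes> inv h = t \<otimes> s"
    using conj_mult[OF h(1) s(1) t(1)] zw s t by simp
  have "(s \<otimes> t) \<otimes> h = h \<otimes> (s \<otimes> t)"
    using lifts_commuteD[of "s \<otimes> t" h] comm s t h by (simp add: proj_mult)
  then have "h \<otimes> (s \<otimes> t) \<otimes> inv h = s \<otimes> t" using s t h by (metis inv_solve_right m_closed)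
  then have "s \<otimes> t = t \<otimes> s" using 1 by simp
  then show ?thesis using lifts_commuteI[of s t] s t by simp
qed

text \<open>The commutator of the lifts of a transposition and of a disjoint one squares to the identity,
  and conjugation by (a c)(b d) shows that it is the same for both factors of (a b)(c d).\<close>

lemma lifts_commute_double_transpos:
  assumes dist: "distinct [a, b, c, d, e, f]" and sub: "{a, b, c, d, e, f} \<subseteq> {1..n}"
  shows "lifts_commute (transpos a b \<circ> transpos c d) (transpos e f)"
proof -
  let ?g = "transpos a c \<circ> transpos b d"
  have g: "?g permutes {1..n}" using sub by (intro permutes_compose transpos_permutes) auto
  obtain s u h where s: "s \<in> carrier H" "\<pi> s = transpos a b" and u: "u \<in> carrier H" "\<pi> u = transpos e f"
    and h: "h \<in> carrier H" "\<pi> h = ?g"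
    using proj_surj transpos_permutes sub g by (metis insert_subset)
  \<comment> \<open>With t an exact conjugate of s, conjugation by h carries the commutator z of s
    and u over to t and u: u changes only by the central w, which cancels.\<close>
  define t where "t = h \<otimes> s \<otimes> inv h"
  have t: "t \<in> carrier H" "\<pi> t = transpos c d"
    using s h conj_transpos[OF g, of a b] dist by (auto simp: t_def proj_mult proj_inv Transposition.transpose_def)
  have "transpos a b \<circ> transpos e f = transpos e f \<circ> transpos a b"
    using dist by (intro transpos_comm) auto
  then obtain z where z: "z \<in> carrier H" "\<pi> z = id" "s \<otimes> u = z \<otimes> (u \<otimes> s)"
    using same_proj[of "u \<otimes> s" "s \<otimes> u"] s u by (auto simp: proj_mult)
  have "?g \<circ> transpos e f \<circ> inv' ?g = transpos e f"
    using conj_transpos[OF g] dist by (auto simp: Transposition.transpose_def)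
  then obtain w where w: "w \<in> carrier H" "\<pi> w = id" "h \<otimes> u \<otimes> inv h = w \<otimes> u"
    using conj_lift[OF h(1) u(1) u(1)] u h by metis
  have zc: "z \<otimes> x = x \<otimes> z" and wc: "w \<otimes> x = x \<otimes> w" if "x \<in> carrier H" for x
    using kernel_commutes z w that by auto
  have "w \<otimes> (t \<otimes> u) = t \<otimes> (w \<otimes> u)"
    using wc[OF t(1)] t w u by (metis m_assoc)
  also have "\<dots> = h \<otimes> (s \<otimes> u) \<otimes> inv h"
    unfolding t_def w(3)[symmetric] using conj_mult h s u by simp
  also have "\<dots> = h \<otimes> z \<otimes> (u \<otimes> s) \<otimes> inv h"
    unfolding z(3) using h z u s by (simp add: m_assoc)
  also have "\<dots> = z \<otimes> (h \<otimes> (u \<otimes> s) \<otimes> inv h)"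
    unfolding zc[OF h(1), symmetric] using h z u s by (simp add: m_assoc)
  also have "\<dots> = z \<otimes> ((w \<otimes> u) \<otimes> t)"
    unfolding t_def w(3)[symmetric] using conj_mult h s u by simp
  also have "\<dots> = w \<otimes> (z \<otimes> (u \<otimes> t))"
    using zc[OF w(1)] z w u t by (metis m_assoc m_closed)
  finally have tu: "t \<otimes> u = z \<otimes> (u \<otimes> t)" using t w u z by simp
  \<comment> \<open>Used twice: for x = y = s, whose square is central, it yields z z = 1; for x = s
    and y = t it then shows that s t commutes with u.\<close>
  have twice: "x \<otimes> (y \<otimes> u) = z \<otimes> z \<otimes> (u \<otimes> (x \<otimes> y))"
    if "x \<in> carrier H" "y \<in> carrier H" "x \<otimes> u = z \<otimes> (u \<otimes> x)" "y \<otimes> u = z \<otimes> (u \<otimes> y)" for x y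
  proof -
    have "x \<otimes> (y \<otimes> u) = z \<otimes> ((x \<otimes> u) \<otimes> y)"
      unfolding that(4) using zc[OF that(1)] that z u by (metis m_assoc m_closed)
    then show ?thesis unfolding that(3) using that(1,2) z u by (simp add: m_assoc)
  qed
  have "s \<otimes> (s \<otimes> u) = u \<otimes> (s \<otimes> s)" using square_central[OF s(1) u(1)] s by simp
  then have "z \<otimes> z = \<one>"
    using twice[OF s(1) s(1) z(3) z(3)] r_cancel_one[of "u \<otimes> (s \<otimes> s)" "z \<otimes> z"] z s u by simp
  then have "(s \<otimes> t) \<otimes> u = u \<otimes> (s \<otimes> t)"
    using twice[OF s(1) t(1) z(3) tu] s t u by (simp add: m_assoc)
  then show ?thesis using lifts_commuteI[of "s \<otimes> t" u] s t u by (simp add: proj_mult)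
qed

text \<open>The preimage of a cyclic group in a central extension is abelian. The closure property
  is applied twice, first to p against the generator g, then to q against p.\<close>

lemma cyclic_imp_lifts_commute:
  assumes p: "p permutes {1..n}" and q: "q permutes {1..n}"
    and cyc: "cyclic_group (subgroup_generated (sym_group n) {p, q})"
  shows "lifts_commute p q"
proof -
  interpret S: group "sym_group n" by (rule sym_group_is_group)
  have pq: "p \<in> carrier (sym_group n)" "q \<in> carrier (sym_group n)"
    using p q by (simp_all add: sym_group_carrier)
  obtain g where g: "g \<in> generate (sym_group n) {p, q}"
    "p \<in> generate (sym_group n) {g}" "q \<in> generate (sym_group n) {g}"
    using cyc S.cyclic_pair_iff[OF pq] by blast
  have gc: "{g} \<subseteq> carrier (sym_group n)" using S.generate_in_carrier[OF _ g(1)] pq by blast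
  have g_perm: "g permutes {1..n}" using gc by (simp add: sym_group_carrier)
  have "lifts_commute p g"
    by (rule lifts_commute_generate[OF gc g_perm _ g(2)]) (use lifts_commute_refl g_perm in blast)
  then have "lifts_commute g p" by (rule lifts_commute_sym)
  then have "lifts_commute q p"
    by (intro lifts_commute_generate[OF gc p _ g(3)]) blast
  then show ?thesis by (rule lifts_commute_sym)
qed

end

section \<open>Commuting lifts in degrees 4 and 5\<close>

context sym_schur_cover
begin

text \<open>Both configurations reduce to commuting lifts of disjoint transpositions: the regular
  one by \<open>lifts_commute_regular\<close>, the other because p q also lifts compatibly with p,
  and a factor (c d) of p can be divided off.\<close>

lemma lifts_commute_involutions:
  assumes n: "n \<le> 5" and p: "p permutes {1..n}" and q: "q permutes {1..n}"
    and inv: "p \<circ> p = id" "q \<circ> q = id" and ne: "p \<noteq> id" "q \<noteq> id"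
    and comm: "lifts_commute p q"
  shows "p = q"
proof (rule ccontr)
  assume pq: "p \<noteq> q"
  have app: "p (p i) = i" "q (q i) = i" "p (q i) = q (p i)" for i
    using inv lifts_commute_imp_comm[OF comm p q] by (metis comp_apply id_apply)+
  show False
  proof (rule commuting_involutions_cases[OF n p q app ne pq])
    fix a b c d
    assume abcd: "distinct [a, b, c, d]" "{a, b, c, d} \<subseteq> {1..n}"
      "p = transpos a b \<circ> transpos c d" "q = transpos a c \<circ> transpos b d"
    then show False
      using not_lifts_commute_disjoint_transpos[OF abcd(1,2)] lifts_commute_regular[OF abcd(1,2)] comm
      by simp
  next
    fix a b c d
    assume abcd: "distinct [a, b, c, d]" "{a, b, c, d} \<subseteq> {1..n}"
      and t: "transpos c d \<in> {q, p \<circ> q}" and p': "p \<in> {transpos a b, transpos a b \<circ> transpos c d}"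
    have ab: "transpos a b permutes {1..n}" and cd: "transpos c d permutes {1..n}"
      using abcd(2) transpos_permutes by blast+
    have ppq: "lifts_commute (p \<circ> q) p"
      using lifts_commute_comp lifts_commute_refl lifts_commute_sym comm p q by blast
    then have pcd: "lifts_commute p (transpos c d)"
      using t comm lifts_commute_sym[OF ppq] by (elim insertE) simp_all
    have "lifts_commute (transpos a b) (transpos c d)"
    proof (cases "p = transpos a b")
      case False
      then have "p \<circ> transpos c d = transpos a b" using p' by (simp add: comp_assoc)
      then show ?thesis
        using lifts_commute_comp[OF pcd lifts_commute_refl[OF cd] p cd cd] by simp
    qed (use pcd in simp)
    then show False using not_lifts_commute_disjoint_transpos abcd by blast
  qed
qed

text \<open>Commuting lifts of p and q pass to all pairs in <p, q>, so this abelian group has at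
  most one involution, and its order divides 120.\<close>

lemma lifts_commute_imp_cyclic:
  assumes n: "n \<in> {4, 5}" and p: "p permutes {1..n}" and q: "q permutes {1..n}"
    and comm: "lifts_commute p q"
  shows "cyclic_group (subgroup_generated (sym_group n) {p, q})"
proof -
  interpret S: group "sym_group n" by (rule sym_group_is_group)
  let ?K = "subgroup_generated (sym_group n) {p, q}" and ?gen = "generate (sym_group n) {p, q}"
  have pq: "{p, q} \<subseteq> carrier (sym_group n)" using p q by (simp add: sym_group_carrier)
  have n5: "n \<le> 5" using n by auto
  have pq': "p \<in> carrier (sym_group n)" "q \<in> carrier (sym_group n)" using pq by auto
  have carr: "carrier ?K = ?gen" using pq by (simp add: carrier_subgroup_generated)
  have ops: "x \<otimes>\<^bsub>?K\<^esub> y = x \<circ> y" "\<one>\<^bsub>?K\<^esub> = id" for x y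
    by (simp_all add: subgroup_generated_def sym_group_mult sym_group_one)
  have sub: "subgroup ?gen (sym_group n)" using pq by (rule S.generate_is_subgroup)
  have perm: "x permutes {1..n}" if "x \<in> ?gen" for x
    using subgroup.mem_carrier[OF sub that] by (simp add: sym_group_carrier)
  have lc1: "lifts_commute x s" if "s \<in> {p, q}" "x \<in> ?gen" for x s
    by (rule lifts_commute_generate[OF pq _ _ that(2)])
      (use that(1) comm p q lifts_commute_sym lifts_commute_refl in auto)
  have lc: "lifts_commute x y" if "x \<in> ?gen" "y \<in> ?gen" for x y
    using lifts_commute_generate[OF pq perm[OF that(1)] lifts_commute_sym that(2)] lc1 that(1) lifts_commute_sym
    by blast
  have "p \<otimes>\<^bsub>sym_group n\<^esub> q = q \<otimes>\<^bsub>sym_group n\<^esub> p"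
    using lifts_commute_imp_comm[OF comm p q] by (simp add: sym_group_mult)
  then interpret K: comm_group ?K using S.comm_group_generated_pair[OF pq'] by blast
  have "order ?K dvd order (sym_group n)"
    using S.lagrange[OF sub] carr by (metis dvd_triv_right order_def)
  also have "order (sym_group n) dvd 120"
    using n by (auto simp: order_def sym_group_card_carrier fact_numeral)
  finally have dvd: "order ?K dvd 120" .
  have "\<exists>g \<in> carrier ?K. p \<in> generate ?K {g} \<and> q \<in> generate ?K {g}"
  proof (rule K.pair_cyclic_of_order_dvd_120[OF dvd])
    show "p \<in> carrier ?K" "q \<in> carrier ?K" unfolding carr by (auto intro: generate.incl)
    fix x y assume "x \<in> carrier ?K" "y \<in> carrier ?K" "x \<otimes>\<^bsub>?K\<^esub> x = \<one>\<^bsub>?K\<^esub>" "y \<otimes>\<^bsub>?K\<^esub> y = \<one>\<^bsub>?K\<^esub>"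
      "x \<noteq> \<one>\<^bsub>?K\<^esub>" "y \<noteq> \<one>\<^bsub>?K\<^esub>"
    then show "x = y"
      using lifts_commute_involutions[OF n5 perm perm] lc unfolding carr ops by blast
  qed
  then obtain g where g: "g \<in> ?gen" "p \<in> generate ?K {g}" "q \<in> generate ?K {g}"
    unfolding carr by blast
  have "generate ?K {g} = generate (sym_group n) {g}"
    using S.generate_consistent[OF _ sub, of "{g}"] g(1) pq
    by (simp add: subgroup_generated_def Int_absorb1)
  then show ?thesis using g S.cyclic_pair_iff[OF pq'] by blast
qed

end

text \<open>Every g in <p, q> = {1, p, q, p q} squares to 1, so <g> = {1, g} cannot contain both p
  and q.\<close>

lemma noncyclic_involutions:
  assumes p: "p permutes {1..n}" and q: "q permutes {1..n}"
    and inv: "p \<circ> p = id" "q \<circ> q = id" and comm: "p \<circ> q = q \<circ> p"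
    and ne: "p \<noteq> id" "q \<noteq> id" "p \<noteq> q"
  shows "\<not> cyclic_group (subgroup_generated (sym_group n) {p, q})"
proof
  interpret S: group "sym_group n" by (rule sym_group_is_group)
  assume "cyclic_group (subgroup_generated (sym_group n) {p, q})"
  then obtain g where g: "g \<in> generate (sym_group n) {p, q}"
    "p \<in> generate (sym_group n) {g}" "q \<in> generate (sym_group n) {g}"
    using S.cyclic_pair_iff p q by (metis sym_group_carrier)
  have pq: "{p, q} \<subseteq> carrier (sym_group n)" using p q by (simp add: sym_group_carrier)
  have inv_eq: "inv\<^bsub>sym_group n\<^esub> x = x" if "x \<in> carrier (sym_group n)" "x \<circ> x = id" for x
    using that by (intro S.inv_equality) (simp_all add: sym_group_mult sym_group_one)
  have gg: "x \<circ> x = id \<and> x \<circ> p = p \<circ> x \<and> x \<circ> q = q \<circ> x" if "x \<in> generate (sym_group n) {p, q}" for x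
  proof -
    have "x \<in> {id, p, q, p \<circ> q}"
      using that
    proof (induction)
      case one
      then show ?case by (simp add: sym_group_one)
    next
      case (inv h)
      then have "inv\<^bsub>sym_group n\<^esub> h = h" using inv_eq pq \<open>p \<circ> p = id\<close> \<open>q \<circ> q = id\<close> by blast
      then show ?case using inv by auto
    next
      case (eng h k)
      have "p \<circ> (p \<circ> q) = q" "q \<circ> (p \<circ> q) = p" "(p \<circ> q) \<circ> p = q" "(p \<circ> q) \<circ> q = p" "(p \<circ> q) \<circ> (p \<circ> q) = id"
        using inv comm by (metis comp_assoc comp_id id_comp)+
      then show ?case using eng inv comm unfolding sym_group_mult by fastforce
    qed auto
    then show ?thesis using inv comm by (elim insertE) (metis comp_assoc comp_id id_comp emptyE)+
  qed
  have gc: "g \<in> carrier (sym_group n)" using S.generate_in_carrier[OF pq g(1)] .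
  have "x \<in> {id, g}" if "x \<in> generate (sym_group n) {g}" for x
    using that
  proof (induction)
    case one
    then show ?case by (simp add: sym_group_one)
  next
    case (inv h)
    then show ?case using inv_eq[OF gc] gg[OF g(1)] by simp
  next
    case (eng h k)
    then show ?case using gg[OF g(1)] unfolding sym_group_mult by fastforce
  qed auto
  then have "p = g" "q = g" using g(2,3) ne by blast+
  then show False using ne by blast
qed

section \<open>The edge sets\<close>

lemma commuting_edges_iff:
  "{x, y} \<in> commuting_edges G \<longleftrightarrow>
    x \<in> carrier G \<and> y \<in> carrier G \<and> x \<noteq> y \<and> x \<otimes>\<^bsub>G\<^esub> y = y \<otimes>\<^bsub>G\<^esub> x"
  unfolding commuting_edges_def by (auto simp: doubleton_eq_iff)

lemma enhanced_power_edges_iff: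
  "{x, y} \<in> enhanced_power_edges G \<longleftrightarrow>
    x \<in> carrier G \<and> y \<in> carrier G \<and> x \<noteq> y \<and> cyclic_group (subgroup_generated G {x, y})"
  unfolding enhanced_power_edges_def by (auto simp: doubleton_eq_iff insert_commute)

context sym_stem_extension
begin

lemma deep_commuting_edges_eq:
  "deep_commuting_edges (sym_group n) H \<pi> =
    {{x, y} | x y. x permutes {1..n} \<and> y permutes {1..n} \<and> x \<noteq> y \<and> lifts_commute x y}"
  unfolding deep_commuting_edges_def lifts_commute_def sym_group_carrier ..

lemma deep_commuting_edges_iff:
  "{x, y} \<in> deep_commuting_edges (sym_group n) H \<pi> \<longleftrightarrow>
    x permutes {1..n} \<and> y permutes {1..n} \<and> x \<noteq> y \<and> lifts_commute x y"
  unfolding deep_commuting_edges_eq using lifts_commute_sym by (auto simp: doubleton_eq_iff)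

lemma enhanced_subset_deep: "enhanced_power_edges (sym_group n) \<subseteq> deep_commuting_edges (sym_group n) H \<pi>"
  unfolding enhanced_power_edges_def deep_commuting_edges_eq sym_group_carrier
  using cyclic_imp_lifts_commute by blast

lemma deep_subset_commuting: "deep_commuting_edges (sym_group n) H \<pi> \<subseteq> commuting_edges (sym_group n)"
  unfolding commuting_edges_def deep_commuting_edges_eq sym_group_carrier sym_group_mult
  using lifts_commute_imp_comm by blast

end

context sym_schur_cover
begin

lemma deep_psubset_commuting: "deep_commuting_edges (sym_group n) H \<pi> \<subset> commuting_edges (sym_group n)"
proof -
  have perm: "transpos 1 2 permutes {1..n}" "transpos 3 4 permutes {1..n}"
    using n_ge by (simp_all add: permutes_swap_id)
  have "transpos 1 2 1 \<noteq> transpos 3 4 1" by (simp add: Transposition.transpose_def)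
  then have ne: "transpos 1 2 \<noteq> transpos 3 4" by metis
  have "transpos 1 2 \<circ> transpos 3 4 = transpos 3 4 \<circ> transpos 1 2"
    by (rule transpos_comm) simp
  then have "{transpos 1 2, transpos 3 4} \<in> commuting_edges (sym_group n)"
    unfolding commuting_edges_iff sym_group_carrier sym_group_mult using perm ne by blast
  moreover have "\<not> lifts_commute (transpos 1 2) (transpos 3 4)"
    by (rule not_lifts_commute_disjoint_transpos) (use n_ge in auto)
  then have "{transpos 1 2, transpos 3 4} \<notin> deep_commuting_edges (sym_group n) H \<pi>"
    unfolding deep_commuting_edges_iff by blast
  ultimately show ?thesis using deep_subset_commuting by blast
qed

lemma deep_eq_enhanced:
  assumes "n \<in> {4, 5}"
  shows "enhanced_power_edges (sym_group n) = deep_commuting_edges (sym_group n) H \<pi>"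
proof
  show "deep_commuting_edges (sym_group n) H \<pi> \<subseteq> enhanced_power_edges (sym_group n)"
    unfolding enhanced_power_edges_def deep_commuting_edges_eq sym_group_carrier
    using lifts_commute_imp_cyclic[OF assms] by blast
qed (rule enhanced_subset_deep)

lemma enhanced_psubset_deep:
  assumes "6 \<le> n"
  shows "enhanced_power_edges (sym_group n) \<subset> deep_commuting_edges (sym_group n) H \<pi>"
proof -
  let ?p = "transpos 1 2 \<circ> transpos 3 4" and ?q = "transpos 5 6"
  have perm: "?p permutes {1..n}" "?q permutes {1..n}"
    using assms by (auto intro!: permutes_compose permutes_swap_id)
  have vals: "?p 1 = 2" "?q 1 = 1" "?q 5 = 6" by (simp_all add: Transposition.transpose_def)
  have "?p \<noteq> id" by (rule notI, drule fun_cong[where x = 1]) (use vals in simp)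
  moreover have "?q \<noteq> id" by (rule notI, drule fun_cong[where x = 5]) (use vals in simp)
  moreover have "?p \<noteq> ?q" by (rule notI, drule fun_cong[where x = 1]) (use vals in simp)
  ultimately have ne: "?p \<noteq> id" "?q \<noteq> id" "?p \<noteq> ?q" .
  have comm: "lifts_commute ?p ?q"
    by (rule lifts_commute_double_transpos) (use assms in auto)
  have "?p \<circ> ?p = id" by (rule double_transpos_involution) simp
  then have "\<not> cyclic_group (subgroup_generated (sym_group n) {?p, ?q})"
    using noncyclic_involutions[OF perm _ _ lifts_commute_imp_comm[OF comm perm] ne] by simp
  then have "{?p, ?q} \<notin> enhanced_power_edges (sym_group n)"
    unfolding enhanced_power_edges_iff by blast
  moreover have "{?p, ?q} \<in> deep_commuting_edges (sym_group n) H \<pi>"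
    unfolding deep_commuting_edges_iff using perm ne comm by blast
  ultimately show ?thesis using enhanced_subset_deep by blast
qed

end

theorem theorem5p18:
  fixes n :: nat and H :: "'b monoid" and \<pi> :: "'b \<Rightarrow> (nat \<Rightarrow> nat)"
  assumes "schur_cover (sym_group n) H \<pi>"
  shows "(n \<in> {4, 5} \<longrightarrow>
            enhanced_power_edges (sym_group n) = deep_commuting_edges (sym_group n) H \<pi> \<and>
            deep_commuting_edges (sym_group n) H \<pi> \<subset> commuting_edges (sym_group n)) \<and>
         (6 \<le> n \<longrightarrow>
            enhanced_power_edges (sym_group n) \<subset> deep_commuting_edges (sym_group n) H \<pi> \<and>
            deep_commuting_edges (sym_group n) H \<pi> \<subset> commuting_edges (sym_group n))"
proof -
  have cover: "sym_schur_cover H n \<pi>" if "4 \<le> n"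
    using assms that by (rule sym_schur_cover.intro)
  show ?thesis
  proof (intro conjI impI)
    assume n: "n \<in> {4, 5}"
    then have "sym_schur_cover H n \<pi>" by (intro cover) auto
    then interpret sym_schur_cover H n \<pi> .
    show "enhanced_power_edges (sym_group n) = deep_commuting_edges (sym_group n) H \<pi>"
      using n by (rule deep_eq_enhanced)
    show "deep_commuting_edges (sym_group n) H \<pi> \<subset> commuting_edges (sym_group n)"
      by (rule deep_psubset_commuting)
  next
    assume n: "6 \<le> n"
    then have "sym_schur_cover H n \<pi>" by (intro cover) simp
    then interpret sym_schur_cover H n \<pi> .
    show "enhanced_power_edges (sym_group n) \<subset> deep_commuting_edges (sym_group n) H \<pi>"
      using n by (rule enhanced_psubset_deep)
    show "deep_commuting_edges (sym_group n) H \<pi> \<subset> commuting_edges (sym_group n)"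
      by (rule deep_psubset_commuting)
  qed
qed

end
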